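(* Let $S_1,\dots,S_q$ be a basis of a linear subspace $\mathcal S\subseteq\mathbb{R}^{m\times n}$, let $A=\sum_{i=1}^qa_iS_i\in\mathcal S$ with $a=[a_1,\dots,a_q]^\top$, and let $b\in\mathbb{R}^m$ be such that the genericity condition $\widetilde\sigma_n>\sigma_{n+1}$ holds. Let $x$ be the unique TLS solution, $r=b-Ax$, $P=A^\top A-\sigma_{n+1}^2I_n$, and $L\in\mathbb{R}^{k\times n}$ with $k\le n$. Let $\mathcal V=\mathbb{R}^k$ be equipped with a norm $\|\cdot\|_{\mathcal V}$, and let $\kappa_s$ be the condition number at $(a,b)$ of $\Psi_s(a,b)=Lx$, where the data space $\mathbb{R}^q\times\mathbb{R}^m$ carries the componentwise norm relative to $(a,b)$ and the solution space carries $\|\cdot\|_{\mathcal V}$. Then $$\kappa_s=\max_{\|u\|_{\mathcal V^*}=1}\left\|\begin{bmatrix}\mathcal N_sD_a&\mathcal HD_b\end{bmatrix}^\top L^\top u\right\|_1=\left\|\begin{bmatrix}\mathcal N_sD_a&\mathcal HD_b\end{bmatrix}^\top L^\top\right\|_{\mathcal V^*,1},$$ where $\mathcal N_s=P^{-1}V$, $V=[v_1,\dots,v_q]\in\mathbb{R}^{n\times q}$ with $v_i=S_i^\top r-\left[A^\top+\frac{2xr^\top}{1+x^\top x}\right]S_ix$, and $\mathcal H=P^{-1}\left[A^\top+\frac{2xr^\top}{1+x^\top x}\right]$.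
   Context: Let $m>n$. The total least squares (TLS) problem for $A\in\mathbb{R}^{m\times n}$, $b\in\mathbb{R}^m$ is to minimize $\|[A,b]-[\widehat A,\widehat b]\|_F$ over $[\widehat A,\widehat b]\in\mathbb{R}^{m\times(n+1)}$ with $\widehat b$ in the range of $\widehat A$; any $x$ with $\widehat A x=\widehat b$ for a minimizer is a TLS solution. Let $\widetilde\sigma_n$ be the smallest singular value of $A$ and $\sigma_{n+1}$ the smallest singular value of $[A,b]$. Under the genericity condition $\widetilde\sigma_n>\sigma_{n+1}$ there is a unique TLS solution $x$; it satisfies $(A^\top A-\sigma_{n+1}^2I_n)x=A^\top b$. $\Psi_s(a,b)=Lx$, where $x$ is the TLS solution for $A=\sum_ia_iS_i$ and $b$; it is defined on those $(a,b)\in\mathbb{R}^q\times\mathbb{R}^m$ satisfying the genericity condition. It is Fréchet differentiable there with derivative $\mathsf d\Psi_s(a,b)\cdot(\mathsf da,\mathsf db)=LP^{-1}V\,\mathsf da+LP^{-1}\left[A^\top+\frac{2xr^\top}{1+x^\top x}\right]\mathsf db$. Componentwise norm on the data space: $\|(\mathsf da,\mathsf db)\|_c=\min\{\omega\ge0:|\mathsf da|\le\omega|a|,\ |\mathsf db|\le\omega|b|\}$ (entrywise), and $=\infty$ if no such $\omega$ exists. The condition number is $\kappa_s=\max_{\|(\mathsf da,\mathsf db)\|_c=1}\|\mathsf d\Psi_s(a,b)\cdot(\mathsf da,\mathsf db)\|_{\mathcal V}$. $\|\cdot\|_{\mathcal V^*}$ is the dual norm of $\|\cdot\|_{\mathcal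 V}$ with respect to the canonical inner product of $\mathbb{R}^k$; $\|B\|_{\mathcal V^*,1}=\max_{\|u\|_{\mathcal V^*}=1}\|Bu\|_1$; $D_a$, $D_b$ are the diagonal matrices with diagonals $a$, $b$. *)

theory Defs
  imports "HOL-Analysis.Analysis"
begin

definition is_maximum :: "real set \<Rightarrow> real \<Rightarrow> bool" where
  "is_maximum X M \<longleftrightarrow> M \<in> X \<and> (\<forall>y\<in>X. y \<le> M)"

definition is_vector_norm :: "('a::real_vector \<Rightarrow> real) \<Rightarrow> bool" where
  "is_vector_norm N \<longleftrightarrow>
     (\<forall>v. 0 \<le> N v) \<and> (\<forall>v. N v = 0 \<longleftrightarrow> v = 0) \<and>
     (\<forall>c v. N (c *\<^sub>R v) = \<bar>c\<bar> * N v) \<and> (\<forall>v w. N (v + w) \<le> N v + N w)"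

definition dual_norm :: "(real^'k \<Rightarrow> real) \<Rightarrow> real^'k \<Rightarrow> real" where
  "dual_norm N u = (SUP v \<in> {v. N v = 1}. u \<bullet> v)"

definition norm1 :: "real^'p \<Rightarrow> real" where
  "norm1 v = (\<Sum>i\<in>UNIV. \<bar>v $ i\<bar>)"

definition dual_one_norm :: "(real^'k \<Rightarrow> real) \<Rightarrow> real^'k^'p \<Rightarrow> real" where
  "dual_one_norm N B = (GREATEST y. y \<in> {norm1 (B *v u) | u. dual_norm N u = 1})"

definition hcat :: "real^'p^'m \<Rightarrow> real^'r^'m \<Rightarrow> real^('p + 'r)^'m" where
  "hcat X Y = (\<chi> i j. case j of Inl s \<Rightarrow> X $ i $ s | Inr t \<Rightarrow> Y $ i $ t)"

definition augmented :: "real^'n^'m \<Rightarrow> real^'m \<Rightarrow> real^('n + 1)^'m" where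
  "augmented A b = hcat A (columnvector b)"

definition diag_mat :: "real^'p \<Rightarrow> real^'p^'p" where
  "diag_mat d = (\<chi> i j. if i = j then d $ i else 0)"

text \<open>The square roots of the eigenvalues of the Gram matrix. These are the singular values
  whenever \<open>M\<close> has at least as many rows as columns; here this covers both \<open>A\<close> and
  \<open>[A, b]\<close>, since \<open>A\<close> has strictly more rows than columns.\<close>

definition singular_values :: "real^'p^'m \<Rightarrow> real set" where
  "singular_values M =
     {s. 0 \<le> s \<and> (\<exists>v. v \<noteq> 0 \<and> (transpose M ** M) *v v = s\<^sup>2 *\<^sub>R v)}"

definition smallest_singular_value :: "real^'p^'m \<Rightarrow> real" where
  "smallest_singular_value M = Min (singular_values M)"

definition tls_generic :: "real^'n^'m \<Rightarrow> real^'m \<Rightarrow> bool" where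
  "tls_generic A b \<longleftrightarrow> smallest_singular_value A > smallest_singular_value (augmented A b)"

text \<open>The Euclidean norm \<^const>\<open>norm\<close> of a matrix, viewed as a vector of row vectors, is its
  Frobenius norm.\<close>

definition tls_minimizer ::
    "real^'n^'m \<Rightarrow> real^'m \<Rightarrow> real^'n^'m \<Rightarrow> real^'m \<Rightarrow> bool" where
  "tls_minimizer A b A' b' \<longleftrightarrow>
     b' \<in> range ((*v) A') \<and>
     (\<forall>A'' b''. b'' \<in> range ((*v) A'') \<longrightarrow>
        norm (augmented A b - augmented A' b') \<le> norm (augmented A b - augmented A'' b''))"

definition is_tls_solution :: "real^'n^'m \<Rightarrow> real^'m \<Rightarrow> real^'n \<Rightarrow> bool" where
  "is_tls_solution A b x \<longleftrightarrow> (\<exists>A' b'. tls_minimizer A b A' b' \<and> A' *v x = b')"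

definition tls_solution :: "real^'n^'m \<Rightarrow> real^'m \<Rightarrow> real^'n" where
  "tls_solution A b = (THE x. is_tls_solution A b x)"

text \<open>The structured solution map. It is meaningful at the data satisfying \<^const>\<open>tls_generic\<close>;
  these form an open set, so its values elsewhere do not affect its derivative there.\<close>

definition structured_tls_map ::
    "('q::finite \<Rightarrow> real^'n^'m) \<Rightarrow> real^'n^'k \<Rightarrow> (real^'q) \<times> (real^'m) \<Rightarrow> real^'k" where
  "structured_tls_map S L = (\<lambda>(a, b). L *v tls_solution (\<Sum>i\<in>UNIV. a $ i *\<^sub>R S i) b)"

text \<open>The componentwise norm relative to \<open>(a, b)\<close>; the infimum over the empty set is
  \<open>\<infinity>\<close>, and the infimum over a nonempty set of admissible \<open>\<omega>\<close> is attained.\<close>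

definition componentwise_norm ::
    "real^'q \<Rightarrow> real^'m \<Rightarrow> real^'q \<Rightarrow> real^'m \<Rightarrow> ereal" where
  "componentwise_norm a b da db =
     Inf (ereal ` {\<omega>. 0 \<le> \<omega> \<and> (\<forall>i. \<bar>da $ i\<bar> \<le> \<omega> * \<bar>a $ i\<bar>) \<and>
                          (\<forall>j. \<bar>db $ j\<bar> \<le> \<omega> * \<bar>b $ j\<bar>)})"

definition componentwise_condition_number ::
    "(real^'k \<Rightarrow> real) \<Rightarrow> ((real^'q) \<times> (real^'m) \<Rightarrow> real^'k) \<Rightarrow> real^'q \<Rightarrow> real^'m \<Rightarrow> real" where
  "componentwise_condition_number N \<Psi> a b =
     (GREATEST y. y \<in> {N (frechet_derivative \<Psi> (at (a, b)) (da, db)) | da db.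
                         componentwise_norm a b da db = 1})"

end

theory Submission
  imports Defs
begin

text \<open>The proof has an analytic part, the derivative of the solution map, and a convex part, the
  evaluation of an operator norm.

  The distance from \<open>[A, b]\<close> to the data that a given \<open>x\<close> solves exactly is the ratio
  \<open>\<rho>(x) = \<bar>b - A x\<bar> / sqrt (1 + \<bar>x\<bar>\<^sup>2)\<close>, so solving the total least squares problem means minimizing
  \<open>\<rho>\<close>. As \<open>\<rho>(x)\<close> is the factor by which \<open>[A, b]\<close> stretches \<open>(x, -1)\<close>, it is at least the smallest
  singular value \<open>\<sigma>\<close> of \<open>[A, b]\<close>. Genericity ensures that a least stretched direction can be scaled
  to the form \<open>(x, -1)\<close>, which attains \<open>\<sigma>\<close>, and the eigenvector property yields
  \<^item> the normal equation \<open>A\<^sup>T r = - \<sigma>\<^sup>2 x\<close>, and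
  \<^item> \<open>\<bar>b - A (x + h)\<bar>\<^sup>2 - \<sigma>\<^sup>2 (1 + \<bar>x + h\<bar>\<^sup>2) = \<bar>A h\<bar>\<^sup>2 - \<sigma>\<^sup>2 \<bar>h\<bar>\<^sup>2\<close>
  (\<open>tls_residual_expansion\<close>). By genericity the right-hand side of the latter is at least a positive
  multiple of \<open>\<bar>h\<bar>\<^sup>2\<close>. Hence the solution is unique, near-minimizers of \<open>\<rho>\<close> are close to it, and the
  solution map is continuous (\<open>isCont_tls_solution\<close>).

  The solution is a zero of \<open>A\<^sup>T r + \<rho>(x)\<^sup>2 x\<close>. By the normal equation the partial derivative of this
  expression in \<open>x\<close> is \<open>-P\<close>, which is negative definite, and its derivative in \<open>(A, b)\<close> is
  \<open>dA\<^sup>T r + K (db - dA x)\<close>. Implicit differentiation (\<open>has_derivative_implicit\<close>) then gives the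
  derivative of the solution; continuity of the solution map replaces the existence part of an
  implicit function theorem.

  Finally, writing \<open>da = D\<^sub>a s\<close> and \<open>db = D\<^sub>b t\<close> turns the unit sphere of the componentwise norm into a
  set of vectors \<open>z = (s, t)\<close> between the sign vectors and the unit cube, and the derivative into \<open>B\<^sup>T z\<close>
  with \<open>B = [N\<^sub>s D\<^sub>a, H D\<^sub>b]\<^sup>T L\<^sup>T\<close>. The maximum of \<open>\<bar>B\<^sup>T z\<bar>\<^sub>V\<close> over such a set and the maximum of
  \<open>\<bar>B u\<bar>\<^sub>1\<close> over the dual unit sphere both equal the maximum of \<open>u \<bullet> B\<^sup>T z = B u \<bullet> z\<close>
  (\<open>max_norm_duality\<close>).\<close>

section \<open>Block vectors and block matrices\<close>

definition vconcat :: "real^'p \<Rightarrow> real^'r \<Rightarrow> real^('p + 'r)" where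
  "vconcat v w = (\<chi> i. case i of Inl s \<Rightarrow> v $ s | Inr t \<Rightarrow> w $ t)"

lemma sum_UNIV_Plus:
  "(\<Sum>i\<in>(UNIV :: ('p::finite + 'r::finite) set). f i) =
     (\<Sum>s\<in>UNIV. f (Inl s)) + (\<Sum>t\<in>UNIV. f (Inr t) :: 'a::comm_monoid_add)"
  using sum.Plus[of "UNIV :: 'p set" "UNIV :: 'r set" f] by simp

lemma vconcat_exists: "\<exists>v w. z = vconcat v w"
proof (intro exI)
  show "z = vconcat (\<chi> s. z $ Inl s) (\<chi> t. z $ Inr t)"
    by (auto simp: vconcat_def vec_eq_iff split: sum.splits)
qed

lemma inner_vconcat: "vconcat v w \<bullet> vconcat v' w' = v \<bullet> v' + w \<bullet> w'"
  by (simp add: vconcat_def inner_vec_def sum_UNIV_Plus)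

lemma hcat_mult_vconcat: "hcat X Y *v vconcat v w = X *v v + Y *v w"
  by (simp add: vec_eq_iff matrix_vector_mult_def hcat_def vconcat_def sum_UNIV_Plus)

lemma inner_hcat: "hcat X Y \<bullet> hcat X' Y' = X \<bullet> X' + Y \<bullet> Y'"
  by (simp add: hcat_def inner_vec_def sum_UNIV_Plus sum.distrib)

lemma inner_matrix_vector:
  fixes B :: "real^'n^'m"
  shows "u \<bullet> (B *v z) = (transpose B *v u) \<bullet> z"
  by (simp add: dot_lmul_matrix)

lemma norm_matrix_vector_le:
  fixes B :: "real^'n^'m"
  shows "norm (B *v z) \<le> norm B * norm z"
proof -
  have "norm (B *v z) = L2_set (\<lambda>i. norm (B $ i \<bullet> z)) UNIV"
    by (simp add: norm_vec_def matrix_vector_mul_component)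
  also have "\<dots> \<le> L2_set (\<lambda>i. norm (B $ i) * norm z) UNIV"
    by (rule L2_set_mono) (auto simp: Cauchy_Schwarz_ineq2)
  also have "\<dots> = norm B * norm z"
    by (simp add: norm_vec_def[of B] L2_set_left_distrib)
  finally show ?thesis .
qed

lemma bounded_bilinear_matrix_vector:
  "bounded_bilinear (\<lambda>(B :: real^'n^'m) z. B *v z)"
proof (rule bounded_bilinear.intro)
  show "\<exists>K. \<forall>(B :: real^'n^'m) z. norm (B *v z) \<le> norm B * norm z * K"
    using norm_matrix_vector_le by (intro exI[of _ 1]) auto
qed (auto simp: matrix_vector_mult_add_rdistrib matrix_vector_right_distrib
      matrix_vector_mult_scaleR scaleR_matrix_vector_assoc)

text \<open>\<open>(v, t)\<close> in the column format of \<^const>\<open>augmented\<close>.\<close>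

definition extend :: "real^'n \<Rightarrow> real \<Rightarrow> real^('n + 1)" where
  "extend v t = vconcat v (vec t)"

lemma extend_exists: "\<exists>v t. z = extend v t"
proof -
  obtain v w where "z = vconcat v w"
    using vconcat_exists by blast
  moreover have "w = vec (w $ 1)"
    by (simp add: vec_eq_iff)
  ultimately show ?thesis
    unfolding extend_def by metis
qed

lemma inner_extend: "extend v t \<bullet> extend v' t' = v \<bullet> v' + t * t'"
  unfolding extend_def inner_vconcat by (simp add: inner_vec_def)

lemma norm_extend: "norm (extend v t) = norm (v, t)"
  by (simp add: norm_eq_sqrt_inner inner_extend)

lemma augmented_mult_extend: "augmented A b *v extend v t = A *v v + t *\<^sub>R b"
  unfolding augmented_def extend_def hcat_mult_vconcat
  by (simp add: vec_eq_iff matrix_vector_mult_def columnvector_def)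

lemma norm_augmented:
  fixes A :: "real^'n^'m"
  shows "norm (augmented A b) = norm (A, b)"
proof -
  have "(columnvector b :: real^1^'m) \<bullet> columnvector b = b \<bullet> b"
    by (simp add: inner_vec_def columnvector_def)
  then show ?thesis
    unfolding augmented_def norm_eq_sqrt_inner inner_hcat by simp
qed

lemma augmented_diff: "augmented A b - augmented A' b' = augmented (A - A') (b - b')"
  by (auto simp: augmented_def hcat_def columnvector_def vec_eq_iff split: sum.splits)

section \<open>The smallest singular value\<close>

lemma inner_gram:
  fixes M :: "real^'p^'m"
  shows "((transpose M ** M) *v v) \<bullet> w = (M *v v) \<bullet> (M *v w)"
  by (simp add: matrix_vector_mul_assoc[symmetric] inner_matrix_vector)

text \<open>A direction in which \<open>M\<close> stretches least is a critical point of the nonnegative quadratic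
  form \<open>\<bar>M v\<bar>\<^sup>2 - s\<^sup>2 \<bar>v\<bar>\<^sup>2\<close>. Perturbing it by a multiple of the residual of the eigenvalue
  equation would make the form negative unless that residual vanishes.\<close>

lemma least_stretched_eigenvector:
  fixes M :: "real^'p^'m"
  assumes least: "\<And>v. s * norm v \<le> norm (M *v v)" and s: "0 \<le> s"
    and eq: "norm (M *v w) = s * norm w"
  shows "(transpose M ** M) *v w = s\<^sup>2 *\<^sub>R w"
proof -
  define g where "g = (transpose M ** M) *v w - s\<^sup>2 *\<^sub>R w"
  define c where "c = (norm (M *v g))\<^sup>2 - s\<^sup>2 * (norm g)\<^sup>2"
  have nonneg: "0 \<le> 2 * t * (g \<bullet> g) + t\<^sup>2 * c" for t
  proof -
    have "s\<^sup>2 * (norm (w + t *\<^sub>R g))\<^sup>2 \<le> (norm (M *v (w + t *\<^sub>R g)))\<^sup>2"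
      using power_mono[OF least, of "w + t *\<^sub>R g" 2] s by (simp add: power_mult_distrib)
    moreover have expand: "(norm (v + t *\<^sub>R h))\<^sup>2 = (norm v)\<^sup>2 + 2 * t * (v \<bullet> h) + t\<^sup>2 * (norm h)\<^sup>2"
      for v h :: "real^'a"
      unfolding power2_norm_eq_inner
      by (simp add: inner_simps inner_commute power2_eq_square algebra_simps)
    moreover have "(norm (M *v (w + t *\<^sub>R g)))\<^sup>2
        = (norm (M *v w))\<^sup>2 + 2 * t * ((M *v w) \<bullet> (M *v g)) + t\<^sup>2 * (norm (M *v g))\<^sup>2"
      by (simp add: expand matrix_vector_right_distrib matrix_vector_mult_scaleR)
    moreover have "(norm (M *v w))\<^sup>2 = s\<^sup>2 * (norm w)\<^sup>2"
      by (simp add: eq power_mult_distrib)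
    moreover have "(M *v w) \<bullet> (M *v g) = g \<bullet> g + s\<^sup>2 * (w \<bullet> g)"
      by (subst (2) g_def) (simp add: inner_diff_left inner_gram)
    ultimately show ?thesis
      unfolding c_def using expand[of w g] by (simp add: algebra_simps)
  qed
  have "g \<bullet> g = 0"
  proof (rule ccontr)
    assume "g \<bullet> g \<noteq> 0"
    then have pos: "0 < g \<bullet> g"
      by (simp add: order_less_le)
    have c: "0 \<le> \<bar>c\<bar>" by simp
    \<comment> \<open>A step against \<open>g\<close>, short enough that the quadratic term cannot outweigh the linear one.\<close>
    define t where "t = - (g \<bullet> g) / (1 + \<bar>c\<bar>)"
    have t: "t < 0" "- t * (1 + \<bar>c\<bar>) = g \<bullet> g"
      using pos unfolding t_def by (auto simp: field_simps add_pos_nonneg add_nonneg_eq_0_iff)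
    have "0 \<le> t * (2 * (g \<bullet> g) + t * c)"
      using nonneg[of t] by (simp add: algebra_simps power2_eq_square)
    then have "2 * (g \<bullet> g) + t * c \<le> 0"
      using t(1) by (simp add: zero_le_mult_iff)
    moreover have "\<bar>t * c\<bar> \<le> - t * (1 + \<bar>c\<bar>)"
      using t(1) by (simp add: abs_mult algebra_simps)
    ultimately show False
      using t(2) pos by linarith
  qed
  then show ?thesis
    by (simp add: g_def)
qed

lemma finite_singular_values:
  fixes M :: "real^'p^'m"
  shows "finite (singular_values M)"
proof -
  define e where "e s = (SOME v. v \<noteq> 0 \<and> (transpose M ** M) *v v = s\<^sup>2 *\<^sub>R v)" for s
  have e: "e s \<noteq> 0" "(transpose M ** M) *v e s = s\<^sup>2 *\<^sub>R e s" if "s \<in> singular_values M" for s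
    using someI_ex[of "\<lambda>v. v \<noteq> 0 \<and> (transpose M ** M) *v v = s\<^sup>2 *\<^sub>R v"] that
    unfolding e_def singular_values_def by auto
  \<comment> \<open>Eigenvectors of a symmetric matrix for distinct eigenvalues are orthogonal.\<close>
  have orth: "e s \<bullet> e t = 0" if "s \<in> singular_values M" "t \<in> singular_values M" "s \<noteq> t" for s t
  proof -
    have "s\<^sup>2 * (e s \<bullet> e t) = (M *v e s) \<bullet> (M *v e t)"
      using e(2)[OF that(1)] inner_gram[of M "e s" "e t"] by simp
    also have "\<dots> = t\<^sup>2 * (e s \<bullet> e t)"
      using e(2)[OF that(2)] inner_gram[of M "e t" "e s"] by (simp add: inner_commute)
    finally have "(s\<^sup>2 - t\<^sup>2) * (e s \<bullet> e t) = 0"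
      by (simp add: algebra_simps)
    moreover have "s\<^sup>2 \<noteq> t\<^sup>2"
      using that unfolding singular_values_def by (auto simp: power2_eq_iff)
    ultimately show ?thesis by simp
  qed
  have "inj_on e (singular_values M)"
    using orth e(1) by (metis inj_onI inner_eq_zero_iff)
  moreover have "independent (e ` singular_values M)"
  proof (rule pairwise_orthogonal_independent)
    show "pairwise orthogonal (e ` singular_values M)"
      unfolding pairwise_def orthogonal_def using orth by blast
  qed (use e(1) in auto)
  then have "finite (e ` singular_values M)"
    by (rule independent_imp_finite)
  ultimately show ?thesis
    by (simp add: finite_image_iff)
qed

text \<open>The least stretch on the unit sphere is attained by compactness and is a singular value by the
  preceding eigenvalue equation; every other singular value is the stretch of some vector.
  Finiteness matters because \<^const>\<open>Min\<close> is unspecified on infinite sets.\<close>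

lemma smallest_singular_value:
  fixes M :: "real^'p^'m"
  shows smallest_singular_value_nonneg: "0 \<le> smallest_singular_value M"
    and smallest_singular_value_le: "smallest_singular_value M * norm v \<le> norm (M *v v)"
    and smallest_singular_value_attained:
      "\<exists>w. norm w = 1 \<and> norm (M *v w) = smallest_singular_value M"
proof -
  have "compact (sphere (0::real^'p) 1)" "sphere (0::real^'p) 1 \<noteq> {}"
    by auto
  then obtain w where w: "norm w = 1" "\<And>v. norm v = 1 \<Longrightarrow> norm (M *v w) \<le> norm (M *v v)"
    using continuous_attains_inf[of "sphere 0 1" "\<lambda>v. norm (M *v v)"]
      continuous_on_norm[OF matrix_vector_mult_linear_continuous_on]
    by (metis mem_sphere_0)
  define s where "s = norm (M *v w)"
  have least: "s * norm v \<le> norm (M *v v)" for v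
  proof (cases "v = 0")
    case False
    then have "s \<le> norm (M *v (v /\<^sub>R norm v))"
      unfolding s_def by (intro w(2)) simp
    also have "\<dots> = norm (M *v v) / norm v"
      by (simp add: matrix_vector_mult_scaleR divide_inverse_commute)
    finally show ?thesis
      using False by (simp add: field_simps)
  qed simp
  have "(transpose M ** M) *v w = s\<^sup>2 *\<^sub>R w"
    by (rule least_stretched_eigenvector[OF least]) (auto simp: s_def w(1))
  then have mem: "s \<in> singular_values M"
    using w(1) unfolding singular_values_def by (auto simp: s_def intro!: exI[of _ w])
  have "s \<le> t" if t: "t \<in> singular_values M" for t
  proof -
    obtain v where v: "0 \<le> t" "v \<noteq> 0" "(transpose M ** M) *v v = t\<^sup>2 *\<^sub>R v"
      using t unfolding singular_values_def by auto
    have "(norm (M *v v))\<^sup>2 = (t * norm v)\<^sup>2"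
      using inner_gram[of M v v] v(3) by (simp add: power2_norm_eq_inner power_mult_distrib)
    then have "norm (M *v v) = t * norm v"
      using v(1) by (simp add: power2_eq_iff_nonneg)
    then show ?thesis
      using least[of v] v(2) by simp
  qed
  then have eq: "smallest_singular_value M = s"
    unfolding smallest_singular_value_def
    using mem finite_singular_values by (intro Min_eqI) auto
  show "0 \<le> smallest_singular_value M" "smallest_singular_value M * norm v \<le> norm (M *v v)"
    "\<exists>w. norm w = 1 \<and> norm (M *v w) = smallest_singular_value M"
    using eq s_def least w(1) by auto
qed

lemma smallest_singular_value_Lipschitz:
  fixes M M' :: "real^'p^'m"
  shows "smallest_singular_value M \<le> smallest_singular_value M' + norm (M - M')"
proof -
  obtain w where w: "norm w = 1" "norm (M' *v w) = smallest_singular_value M'"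
    using smallest_singular_value_attained by blast
  have "smallest_singular_value M \<le> norm (M *v w)"
    using smallest_singular_value_le[of M w] w(1) by simp
  also have "M *v w = M' *v w + (M - M') *v w"
    by (simp add: matrix_vector_mult_diff_rdistrib)
  also have "norm \<dots> \<le> norm (M' *v w) + norm (M - M')"
    using norm_triangle_ineq norm_matrix_vector_le[of "M - M'" w] w(1)
    by (metis add_left_mono mult.right_neutral order_trans)
  finally show ?thesis
    using w(2) by simp
qed

section \<open>Total least squares as the minimization of a ratio\<close>

text \<open>The square of the following ratio is the Rayleigh quotient of \<open>[A, b]\<^sup>T [A, b]\<close> at \<open>(x, -1)\<close>.\<close>

definition tls_ratio :: "real^'n^'m \<Rightarrow> real^'m \<Rightarrow> real^'n \<Rightarrow> real" where
  "tls_ratio A b x = norm (b - A *v x) / sqrt (1 + x \<bullet> x)"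

lemma one_plus_inner_pos: "0 < 1 + x \<bullet> (x :: 'a::real_inner)"
  by (simp add: add_pos_nonneg)

lemma norm_extend_minus_one: "norm (extend x (-1)) = sqrt (1 + x \<bullet> x)"
  by (simp add: norm_eq_sqrt_inner inner_extend add.commute)

lemma tls_ratio_eq_stretch:
  "tls_ratio A b x * norm (extend x (-1)) = norm (augmented A b *v extend x (-1))"
  using one_plus_inner_pos[of x]
  by (simp add: tls_ratio_def norm_extend_minus_one augmented_mult_extend norm_minus_commute)

lemma tls_ratio_nonneg: "0 \<le> tls_ratio A b x"
  by (simp add: tls_ratio_def)

lemma tls_ratio_Lipschitz:
  "tls_ratio A b x \<le> tls_ratio A' b' x + norm (augmented A b - augmented A' b')"
proof -
  let ?w = "extend x (-1)"
  have pos: "0 < norm ?w"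
    using one_plus_inner_pos[of x] by (simp add: norm_extend_minus_one)
  have "augmented A b *v ?w = augmented A' b' *v ?w + (augmented A b - augmented A' b') *v ?w"
    by (simp add: matrix_vector_mult_diff_rdistrib)
  then have "norm (augmented A b *v ?w)
      \<le> norm (augmented A' b' *v ?w) + norm ((augmented A b - augmented A' b') *v ?w)"
    by (simp only: norm_triangle_ineq)
  also have "\<dots> \<le> norm (augmented A' b' *v ?w) + norm (augmented A b - augmented A' b') * norm ?w"
    by (intro add_left_mono norm_matrix_vector_le)
  finally have "tls_ratio A b x * norm ?w
      \<le> (tls_ratio A' b' x + norm (augmented A b - augmented A' b')) * norm ?w"
    by (simp only: tls_ratio_eq_stretch distrib_right)
  then show ?thesis
    using pos by simp
qed

text \<open>The data nearest to \<open>[A, b]\<close> that \<open>x\<close> solves exactly arise by removing from \<open>[A, b]\<close> its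
  action on the line through \<open>(x, -1)\<close>.\<close>

lemma tls_ratio_is_distance:
  fixes A :: "real^'n^'m"
  shows "\<exists>A' b'. A' *v x = b' \<and> norm (augmented A b - augmented A' b') = tls_ratio A b x"
proof -
  define r where "r = b - A *v x"
  define c where "c = 1 / (1 + x \<bullet> x)"
  define R :: "real^'n^'m" where "R = (\<chi> i. r $ i *\<^sub>R x)"
  have c: "0 < c" "c * (1 + x \<bullet> x) = 1"
    using one_plus_inner_pos[of x] unfolding c_def by auto
  have Rx: "R *v x = (x \<bullet> x) *\<^sub>R r"
    by (simp add: R_def vec_eq_iff matrix_vector_mul_component)
  have RR: "R \<bullet> R = (x \<bullet> x) * (r \<bullet> r)"
    by (simp add: R_def inner_vec_def[of "vec_lambda _"] inner_vec_def[of r] sum_distrib_left algebra_simps)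
  let ?A = "A + c *\<^sub>R R"
  have "b - ?A *v x = r - (c * (x \<bullet> x)) *\<^sub>R r"
    by (simp add: matrix_vector_mult_add_rdistrib scaleR_matrix_vector_assoc[symmetric] Rx r_def)
  also have "\<dots> = (1 - c * (x \<bullet> x)) *\<^sub>R r"
    by (simp add: scaleR_diff_left)
  also have "1 - c * (x \<bullet> x) = c"
    using c(2) by (simp add: algebra_simps)
  finally have b: "b - ?A *v x = c *\<^sub>R r" .
  have "norm (augmented A b - augmented ?A (?A *v x)) = norm (- (c *\<^sub>R R), c *\<^sub>R r)"
    unfolding augmented_diff norm_augmented b by simp
  also have "\<dots> = sqrt (c * (c * (1 + x \<bullet> x)) * (r \<bullet> r))"
    by (simp add: norm_eq_sqrt_inner RR algebra_simps)
  also have "\<dots> = sqrt c * norm r"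
    by (simp only: c(2)) (simp add: real_sqrt_mult norm_eq_sqrt_inner)
  also have "\<dots> = tls_ratio A b x"
    by (simp add: tls_ratio_def c_def r_def real_sqrt_divide)
  finally show ?thesis
    by (intro exI[of _ ?A] exI[of _ "?A *v x"] conjI refl)
qed

text \<open>Minimizing over all consistent data amounts to choosing the nearest consistent data for each \<open>x\<close>
  and then minimizing their distance over \<open>x\<close>.\<close>

lemma is_tls_solution_iff:
  fixes A :: "real^'n^'m"
  shows "is_tls_solution A b x \<longleftrightarrow> (\<forall>y. tls_ratio A b x \<le> tls_ratio A b y)"
proof -
  have lower: "tls_ratio A b y \<le> norm (augmented A b - augmented A' b')" if "A' *v y = b'"
    for A' :: "real^'n^'m" and b' y
    using tls_ratio_Lipschitz[of A b y A' b'] that by (simp add: tls_ratio_def)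
  show ?thesis
  proof (intro iffI allI)
    fix y :: "real^'n" assume "is_tls_solution A b x"
    then obtain A' b' where sol: "tls_minimizer A b A' b'" "A' *v x = b'"
      unfolding is_tls_solution_def by blast
    obtain A'' :: "real^'n^'m" and b'' where y: "A'' *v y = b''"
        "norm (augmented A b - augmented A'' b'') = tls_ratio A b y"
      using tls_ratio_is_distance by blast
    have "norm (augmented A b - augmented A' b') \<le> norm (augmented A b - augmented A'' b'')"
      using sol(1) y(1) unfolding tls_minimizer_def by blast
    then show "tls_ratio A b x \<le> tls_ratio A b y"
      using lower[OF sol(2)] y(2) by linarith
  next
    assume min: "\<forall>y. tls_ratio A b x \<le> tls_ratio A b y"
    obtain A' b' where x: "A' *v x = b'"
        "norm (augmented A b - augmented A' b') = tls_ratio A b x"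
      using tls_ratio_is_distance by blast
    have "tls_minimizer A b A' b'"
      unfolding tls_minimizer_def
    proof (intro conjI allI impI)
      fix A'' :: "real^'n^'m" and b'' assume "b'' \<in> range ((*v) A'')"
      then obtain y where "A'' *v y = b''"
        by auto
      then show "norm (augmented A b - augmented A' b') \<le> norm (augmented A b - augmented A'' b'')"
        using lower min x(2) by (metis order_trans)
    qed (use x(1) in auto)
    then show "is_tls_solution A b x"
      unfolding is_tls_solution_def using x(1) by blast
  qed
qed

lemma smallest_singular_value_le_tls_ratio:
  "smallest_singular_value (augmented A b) \<le> tls_ratio A b x"
proof -
  have "smallest_singular_value (augmented A b) * norm (extend x (-1))
      \<le> tls_ratio A b x * norm (extend x (-1))"
    unfolding tls_ratio_eq_stretch by (rule smallest_singular_value_le)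
  then show ?thesis
    using one_plus_inner_pos[of x] by (simp add: norm_extend_minus_one)
qed

section \<open>The solution under the genericity condition\<close>

text \<open>A least stretched direction of \<open>[A, b]\<close> whose last entry is zero would be stretched by \<open>A\<close>
  less than genericity permits, so it can be scaled to the form \<open>(x, -1)\<close>.\<close>

lemma tls_ratio_attains_smallest_singular_value:
  fixes A :: "real^'n^'m"
  assumes gen: "tls_generic A b"
  shows "\<exists>x. tls_ratio A b x = smallest_singular_value (augmented A b)"
proof -
  let ?s = "smallest_singular_value (augmented A b)"
  obtain w where w: "norm w = 1" "norm (augmented A b *v w) = ?s"
    using smallest_singular_value_attained by blast
  obtain v t where vt: "w = extend v t"
    using extend_exists by blast
  have "t \<noteq> 0"
  proof
    assume "t = 0"
    then have "norm v = 1" "norm (A *v v) = ?s"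
      using w by (simp_all add: vt norm_extend augmented_mult_extend)
    then show False
      using smallest_singular_value_le[of A v] gen unfolding tls_generic_def by simp
  qed
  define x where "x = (- 1 / t) *\<^sub>R v"
  have v: "v = (- t) *\<^sub>R x"
    using \<open>t \<noteq> 0\<close> by (simp add: x_def)
  have "augmented A b *v w = (- t) *\<^sub>R (augmented A b *v extend x (-1))"
    unfolding vt augmented_mult_extend v by (simp only: matrix_vector_mult_scaleR) (simp add: algebra_simps)
  then have "norm (augmented A b *v extend x (-1)) * \<bar>t\<bar> = norm (augmented A b *v w)"
    by simp
  moreover have "norm (extend x (-1)) * \<bar>t\<bar> = 1"
  proof -
    have "1 = sqrt (t\<^sup>2 * (1 + x \<bullet> x))"
      using w(1) unfolding vt v norm_eq_sqrt_inner inner_extend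
      by (simp add: power2_eq_square algebra_simps)
    then show ?thesis
      by (simp add: norm_extend_minus_one real_sqrt_mult mult.commute)
  qed
  ultimately have "tls_ratio A b x = ?s"
    using w(2) tls_ratio_eq_stretch[of A b x]
    by (metis mult.assoc mult.right_neutral)
  then show ?thesis ..
qed

text \<open>Since \<open>(x, -1)\<close> is an eigenvector of \<open>[A, b]\<^sup>T [A, b]\<close>, the form
  \<open>\<bar>[A, b] w\<bar>\<^sup>2 - \<sigma>\<^sup>2 \<bar>w\<bar>\<^sup>2\<close> at \<open>w = (x + h, -1)\<close> has neither a constant nor a linear term in \<open>h\<close>.
  Uniqueness and continuity of the solution both rest on this identity.\<close>

lemma tls_residual_expansion:
  fixes A :: "real^'n^'m" and b x
  defines "s \<equiv> smallest_singular_value (augmented A b)"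
  assumes sol: "tls_ratio A b x = s"
  shows tls_normal_equation: "transpose A *v (b - A *v x) = - s\<^sup>2 *\<^sub>R x"
    and "(norm (b - A *v (x + h)))\<^sup>2 - s\<^sup>2 * (1 + (x + h) \<bullet> (x + h))
           = (norm (A *v h))\<^sup>2 - s\<^sup>2 * (h \<bullet> h)"
proof -
  let ?C = "augmented A b" and ?w = "extend x (-1)"
  define r where "r = b - A *v x"
  have "norm (?C *v ?w) = s * norm ?w"
    using tls_ratio_eq_stretch[of A b x] sol by simp
  then have "(transpose ?C ** ?C) *v ?w = s\<^sup>2 *\<^sub>R ?w"
    unfolding s_def by (intro least_stretched_eigenvector smallest_singular_value_le smallest_singular_value_nonneg)
  then have "(?C *v ?w) \<bullet> (?C *v extend v 0) = s\<^sup>2 * (?w \<bullet> extend v 0)" for v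
    using inner_gram[of ?C ?w "extend v 0"] by simp
  moreover have "?C *v ?w = - r"
    by (simp add: augmented_mult_extend r_def)
  ultimately have orth: "r \<bullet> (A *v v) = - s\<^sup>2 * (x \<bullet> v)" for v
    by (simp add: augmented_mult_extend inner_extend minus_equation_iff[of "r \<bullet> _"])
  then have "(transpose A *v r + s\<^sup>2 *\<^sub>R x) \<bullet> v = 0" for v
    by (simp only: inner_matrix_vector inner_add_left inner_scaleR_left)
  then have "transpose A *v r + s\<^sup>2 *\<^sub>R x = 0"
    using inner_eq_zero_iff by blast
  then show "transpose A *v (b - A *v x) = - s\<^sup>2 *\<^sub>R x"
    unfolding r_def by (simp add: eq_neg_iff_add_eq_0)
  have "(norm r)\<^sup>2 = s\<^sup>2 * (1 + x \<bullet> x)"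
  proof -
    have "norm r = s * sqrt (1 + x \<bullet> x)"
      using sol one_plus_inner_pos[of x] by (simp add: tls_ratio_def r_def field_simps)
    then show ?thesis
      using one_plus_inner_pos[of x] by (simp add: power_mult_distrib less_imp_le)
  qed
  moreover have "b - A *v (x + h) = r - A *v h"
    by (simp add: r_def matrix_vector_right_distrib)
  moreover have "(norm (r - A *v h))\<^sup>2 = (norm r)\<^sup>2 - 2 * (r \<bullet> (A *v h)) + (norm (A *v h))\<^sup>2"
    unfolding power2_norm_eq_inner by (simp add: inner_simps inner_commute)
  ultimately show "(norm (b - A *v (x + h)))\<^sup>2 - s\<^sup>2 * (1 + (x + h) \<bullet> (x + h))
           = (norm (A *v h))\<^sup>2 - s\<^sup>2 * (h \<bullet> h)"
    using orth[of h] by (simp add: inner_simps inner_commute algebra_simps)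
qed

lemma spectral_gap:
  fixes A :: "real^'n^'m"
  shows "((smallest_singular_value A)\<^sup>2 - s) * (h \<bullet> h) \<le> (norm (A *v h))\<^sup>2 - s * (h \<bullet> h)"
proof -
  have "(smallest_singular_value A * norm h)\<^sup>2 \<le> (norm (A *v h))\<^sup>2"
    by (intro power_mono smallest_singular_value_le mult_nonneg_nonneg smallest_singular_value_nonneg) simp
  then show ?thesis
    by (simp add: power_mult_distrib power2_norm_eq_inner left_diff_distrib)
qed

lemma tls_gap_pos:
  assumes "tls_generic A b"
  shows "0 < (smallest_singular_value A)\<^sup>2 - (smallest_singular_value (augmented A b))\<^sup>2"
  using assms smallest_singular_value_nonneg[of "augmented A b"]
  unfolding tls_generic_def by (simp add: power_strict_mono)

text \<open>Uniqueness: at a second minimizer the left-hand side of the expansion vanishes, while the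
  right-hand side is bounded below by the gap between the two singular values.\<close>

lemma tls_ratio_tls_solution:
  fixes A :: "real^'n^'m"
  assumes gen: "tls_generic A b"
  shows "tls_ratio A b (tls_solution A b) = smallest_singular_value (augmented A b)"
proof -
  let ?s = "smallest_singular_value (augmented A b)"
  obtain x where x: "tls_ratio A b x = ?s"
    using tls_ratio_attains_smallest_singular_value[OF gen] by blast
  have solution_iff: "is_tls_solution A b y \<longleftrightarrow> tls_ratio A b y = ?s" for y
    using x smallest_singular_value_le_tls_ratio[of A b] unfolding is_tls_solution_iff
    by (metis order_antisym)
  have "y = x" if y: "tls_ratio A b y = ?s" for y
  proof -
    have "(norm (b - A *v y))\<^sup>2 - ?s\<^sup>2 * (1 + y \<bullet> y) = 0"
      using tls_residual_expansion(2)[OF y, of 0] by simp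
    then have "(norm (A *v (y - x)))\<^sup>2 - ?s\<^sup>2 * ((y - x) \<bullet> (y - x)) = 0"
      using tls_residual_expansion(2)[OF x, of "y - x"] by simp
    then have "((smallest_singular_value A)\<^sup>2 - ?s\<^sup>2) * ((y - x) \<bullet> (y - x)) \<le> 0"
      using spectral_gap[of A "?s\<^sup>2" "y - x"] by simp
    then have "(y - x) \<bullet> (y - x) \<le> 0"
      using tls_gap_pos[OF gen] by (simp add: mult_le_0_iff)
    then show ?thesis
      using inner_ge_zero[of "y - x"] by (simp add: order_antisym_conv)
  qed
  then have "tls_solution A b = x"
    unfolding tls_solution_def solution_iff using x by (intro the_equality) blast+
  then show ?thesis
    using x by simp
qed

lemma norm_augmented_diff: "norm (augmented A b - augmented A' b') = norm ((A, b) - (A', b'))"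
  by (simp add: augmented_diff norm_augmented)

text \<open>Singular values are 1-Lipschitz in the data, so the strict inequality survives perturbations
  smaller than half the gap.\<close>

lemma eventually_tls_generic:
  fixes A :: "real^'n^'m"
  assumes gen: "tls_generic A b"
  shows "\<forall>\<^sub>F p in nhds (A, b). tls_generic (fst p) (snd p)"
proof -
  define d where "d = (smallest_singular_value A - smallest_singular_value (augmented A b)) / 2"
  have "0 < d"
    using gen by (simp add: d_def tls_generic_def)
  then have "\<forall>\<^sub>F p in nhds (A, b). dist p (A, b) < d"
    unfolding eventually_nhds_metric by blast
  then show ?thesis
  proof (rule eventually_mono)
    fix p :: "(real^'n^'m) \<times> (real^'m)" assume "dist p (A, b) < d"
    moreover obtain A' b' where p: "p = (A', b')"
      by fastforce
    ultimately have d: "norm ((A', b') - (A, b)) < d"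
      by (simp add: dist_norm)
    have "smallest_singular_value A \<le> smallest_singular_value A' + norm (A' - A)"
      using smallest_singular_value_Lipschitz by (metis norm_minus_commute)
    moreover have "norm (A' - A) \<le> norm ((A', b') - (A, b))"
      using norm_fst_le[of "A' - A" "b' - b"] by simp
    moreover have "smallest_singular_value (augmented A' b')
        \<le> smallest_singular_value (augmented A b) + norm ((A', b') - (A, b))"
      using smallest_singular_value_Lipschitz norm_augmented_diff by metis
    ultimately show "tls_generic (fst p) (snd p)"
      using d unfolding tls_generic_def p d_def by simp
  qed
qed

text \<open>A small perturbation of size \<open>\<epsilon>\<close> moves the minimal ratio, and the ratio at any point, by at
  most \<open>\<epsilon>\<close>. The perturbed solution is therefore nearly optimal for the original data, and the
  spectral gap turns near-optimality into closeness.\<close>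

lemma isCont_tls_solution:
  fixes A :: "real^'n^'m"
  assumes gen: "tls_generic A b"
  shows "isCont (\<lambda>(A, b). tls_solution A b) (A, b)"
proof -
  define s where "s = smallest_singular_value (augmented A b)"
  define x where "x = tls_solution A b"
  define y where "y p = tls_solution (fst p) (snd p)" for p :: "(real^'n^'m) \<times> (real^'m)"
  define \<gamma> where "\<gamma> = (smallest_singular_value A)\<^sup>2 - s\<^sup>2"
  define \<eta> where "\<eta> p = (s + 2 * norm (p - (A, b)))\<^sup>2 - s\<^sup>2" for p
  let ?F = "nhds (A, b)"
  have \<gamma>: "0 < \<gamma>"
    using tls_gap_pos[OF gen] by (simp add: \<gamma>_def s_def)
  have s: "0 \<le> s"
    by (simp add: s_def smallest_singular_value_nonneg)
  have "(\<eta> \<longlongrightarrow> (s + 2 * norm ((A, b) - (A, b)))\<^sup>2 - s\<^sup>2) ?F"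
    unfolding \<eta>_def by (intro tendsto_intros filterlim_ident)
  then have \<eta>: "(\<eta> \<longlongrightarrow> 0) ?F"
    by simp
  then have "\<forall>\<^sub>F p in ?F. \<eta> p < \<gamma> / 4"
    using \<gamma> by (intro order_tendstoD(2)) auto
  moreover note eventually_tls_generic[OF gen]
  ultimately have bound: "\<forall>\<^sub>F p in ?F. (norm (y p - x))\<^sup>2 \<le> 2 * (1 + 2 * (norm x)\<^sup>2) / \<gamma> * \<eta> p"
  proof eventually_elim
    case (elim p)
    define \<epsilon> where "\<epsilon> = norm (p - (A, b))"
    define h where "h = y p - x"
    obtain A' b' where p: "p = (A', b')"
      by fastforce
    have eps: "norm (augmented A b - augmented A' b') = \<epsilon>" "norm (augmented A' b' - augmented A b) = \<epsilon>"
      by (simp_all add: norm_augmented_diff \<epsilon>_def p norm_Pair norm_minus_commute)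
    have "tls_ratio A b (y p) \<le> tls_ratio A' b' (y p) + \<epsilon>"
      using tls_ratio_Lipschitz eps(1) by metis
    also have "tls_ratio A' b' (y p) = smallest_singular_value (augmented A' b')"
      using tls_ratio_tls_solution elim(2) by (simp add: y_def p)
    also have "\<dots> \<le> s + \<epsilon>"
      unfolding s_def using smallest_singular_value_Lipschitz eps(2) by metis
    finally have near: "tls_ratio A b (y p) \<le> s + 2 * \<epsilon>"
      by simp
    have "norm (b - A *v y p) = tls_ratio A b (y p) * sqrt (1 + y p \<bullet> y p)"
      using one_plus_inner_pos[of "y p"] by (simp add: tls_ratio_def)
    then have "(norm (b - A *v y p))\<^sup>2 = (tls_ratio A b (y p))\<^sup>2 * (1 + y p \<bullet> y p)"
      using one_plus_inner_pos[of "y p"] by (simp add: power_mult_distrib less_imp_le)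
    also have "\<dots> \<le> (s + 2 * \<epsilon>)\<^sup>2 * (1 + y p \<bullet> y p)"
      using near tls_ratio_nonneg one_plus_inner_pos[of "y p"]
      by (intro mult_right_mono power_mono) (auto simp: less_imp_le)
    finally have "(norm (b - A *v (x + h)))\<^sup>2 - s\<^sup>2 * (1 + (x + h) \<bullet> (x + h)) \<le> \<eta> p * (1 + y p \<bullet> y p)"
      by (simp add: h_def \<eta>_def \<epsilon>_def left_diff_distrib)
    also have "(norm (b - A *v (x + h)))\<^sup>2 - s\<^sup>2 * (1 + (x + h) \<bullet> (x + h))
        = (norm (A *v h))\<^sup>2 - s\<^sup>2 * (h \<bullet> h)"
      unfolding s_def x_def by (rule tls_residual_expansion(2)[OF tls_ratio_tls_solution[OF gen]])
    finally have "\<gamma> * (norm h)\<^sup>2 \<le> \<eta> p * (1 + y p \<bullet> y p)"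
      using spectral_gap[of A "s\<^sup>2" h] by (simp add: \<gamma>_def power2_norm_eq_inner)
    also have "\<dots> \<le> \<eta> p * (1 + (2 * (norm x)\<^sup>2 + 2 * (norm h)\<^sup>2))"
    proof (intro mult_left_mono add_left_mono)
      have "0 \<le> (x - h) \<bullet> (x - h)"
        by (rule inner_ge_zero)
      moreover have "y p = x + h"
        by (simp add: h_def)
      ultimately show "y p \<bullet> y p \<le> 2 * (norm x)\<^sup>2 + 2 * (norm h)\<^sup>2"
        unfolding power2_norm_eq_inner by (simp add: inner_simps inner_commute)
      have "s\<^sup>2 \<le> (s + 2 * \<epsilon>)\<^sup>2"
        using s by (intro power_mono) (auto simp: \<epsilon>_def)
      then show "0 \<le> \<eta> p"
        by (simp add: \<eta>_def \<epsilon>_def)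
    qed
    also have "\<dots> = \<eta> p * (1 + 2 * (norm x)\<^sup>2) + 2 * \<eta> p * (norm h)\<^sup>2"
      by (simp add: algebra_simps)
    also have "2 * \<eta> p * (norm h)\<^sup>2 \<le> \<gamma> / 2 * (norm h)\<^sup>2"
      using elim(1) by (intro mult_right_mono) auto
    finally have "\<gamma> / 2 * (norm h)\<^sup>2 \<le> \<eta> p * (1 + 2 * (norm x)\<^sup>2)"
      by simp
    then have "(norm h)\<^sup>2 \<le> 2 * (1 + 2 * (norm x)\<^sup>2) / \<gamma> * \<eta> p"
      using \<gamma> by (simp add: field_simps)
    then show ?case
      by (simp add: h_def)
  qed
  have "((\<lambda>p. 2 * (1 + 2 * (norm x)\<^sup>2) / \<gamma> * \<eta> p) \<longlongrightarrow> 0) ?F"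
    using tendsto_mult[OF tendsto_const \<eta>] by (metis mult_zero_right)
  then have "((\<lambda>p. (norm (y p - x))\<^sup>2) \<longlongrightarrow> 0) ?F"
    using bound by (intro tendsto_sandwich[OF _ bound tendsto_const]) auto
  then have "((\<lambda>p. sqrt ((norm (y p - x))\<^sup>2)) \<longlongrightarrow> sqrt 0) ?F"
    by (rule tendsto_real_sqrt)
  then have "(y \<longlongrightarrow> x) ?F"
    by (simp add: tendsto_norm_zero_iff Lim_null[symmetric])
  moreover have "y = (\<lambda>(A, b). tls_solution A b)"
    by (simp add: y_def fun_eq_iff)
  ultimately show ?thesis
    unfolding isCont_def x_def tendsto_at_iff_tendsto_nhds by simp
qed

section \<open>Differentiating the solution implicitly\<close>

text \<open>A continuous branch of solutions of \<open>F (q, g q) = const\<close> inherits differentiability at \<open>p\<close> from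
  \<open>F\<close>. Applying \<open>T\<close> to the expansion of \<open>F\<close> bounds \<open>g q - g p\<close> by its linear part plus a small
  multiple of \<open>\<bar>q - p\<bar> + \<bar>g q - g p\<bar>\<close>; absorbing the second summand gives a Lipschitz bound at \<open>p\<close>,
  and reinserting that bound makes the error \<open>o(\<bar>q - p\<bar>)\<close>.\<close>

lemma has_derivative_implicit:
  fixes F :: "'a::real_normed_vector \<times> 'b::real_normed_vector \<Rightarrow> 'c::real_normed_vector"
  assumes F: "(F has_derivative F') (at (p, g p))"
    and cont: "isCont g p"
    and level: "\<forall>\<^sub>F q in nhds p. F (q, g q) = F (p, g p)"
    and T: "bounded_linear T" "\<And>h. T (F' (0, h)) = h"
  shows "(g has_derivative (\<lambda>v. - T (F' (v, 0)))) (at p)"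
proof -
  define D where "D v = - T (F' (v, 0))" for v
  have F': "bounded_linear F'"
    using F by (rule has_derivative_bounded_linear)
  have D: "bounded_linear D"
    unfolding D_def
    by (intro bounded_linear_minus bounded_linear_compose[OF T(1)] bounded_linear_compose[OF F']
        bounded_linear_Pair bounded_linear_ident bounded_linear_zero)
  obtain B where B: "0 < B" "\<And>y. norm (T y) \<le> norm y * B"
    using bounded_linear.pos_bounded[OF T(1)] by blast
  obtain C where C: "0 < C" "\<And>v. norm (D v) \<le> norm v * C"
    using bounded_linear.pos_bounded[OF D] by blast
  have "\<forall>\<^sub>F q in at p. norm (g q - g p - D (q - p)) \<le> e * norm (q - p)" if e: "0 < e" for e
  proof -
    \<comment> \<open>The first bound absorbs \<open>\<bar>g q - g p\<bar>\<close>; the second makes the resulting error at most \<open>e\<close>.\<close>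
    define \<delta> where "\<delta> = min (1 / (2 * B)) (e / (B * (2 * C + 2)))"
    have \<delta>: "0 < \<delta>" "B * \<delta> \<le> 1 / 2" "B * \<delta> * (2 * C + 2) \<le> e"
    proof -
      show "0 < \<delta>"
        using B(1) C(1) e by (simp add: \<delta>_def)
      have "B * \<delta> \<le> B * (1 / (2 * B))"
        using B(1) by (intro mult_left_mono) (auto simp: \<delta>_def)
      then show "B * \<delta> \<le> 1 / 2"
        using B(1) by simp
      have "B * (2 * C + 2) * \<delta> \<le> B * (2 * C + 2) * (e / (B * (2 * C + 2)))"
        using B(1) C(1) by (intro mult_left_mono) (auto simp: \<delta>_def)
      also have "\<dots> = e"
        using B(1) C(1) by simp
      finally show "B * \<delta> * (2 * C + 2) \<le> e"
        by (simp add: mult_ac)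
    qed
    obtain d where d: "0 < d" "\<And>z. norm (z - (p, g p)) < d \<Longrightarrow>
        norm (F z - F (p, g p) - F' (z - (p, g p))) \<le> \<delta> * norm (z - (p, g p))"
      using F \<delta>(1) unfolding has_derivative_at_alt by blast
    have "((\<lambda>q. (q, g q)) \<longlongrightarrow> (p, g p)) (at p)"
      using cont by (intro tendsto_Pair tendsto_ident_at) (simp add: isCont_def)
    then have "\<forall>\<^sub>F q in at p. norm ((q, g q) - (p, g p)) < d"
      using d(1) unfolding tendsto_iff dist_norm by blast
    moreover have "\<forall>\<^sub>F q in at p. F (q, g q) = F (p, g p)"
      using level by (simp add: eventually_at_filter eventually_mono)
    ultimately show ?thesis
    proof eventually_elim
      case (elim q)
      let ?v = "q - p" and ?\<Delta> = "g q - g p"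
      have "F' (?v, ?\<Delta>) = F' (?v, 0) + F' (0, ?\<Delta>)"
        using bounded_linear.linear[OF F', THEN linear_add, of "(?v, 0)" "(0, ?\<Delta>)"] by simp
      then have "?\<Delta> - D ?v = T (F' (?v, ?\<Delta>))"
        using bounded_linear.linear[OF T(1), THEN linear_add] T(2)[of ?\<Delta>] by (simp add: D_def)
      also have "norm \<dots> \<le> norm (F' (?v, ?\<Delta>)) * B"
        by (rule B(2))
      also have "norm (F' (?v, ?\<Delta>)) \<le> \<delta> * norm (?v, ?\<Delta>)"
        using d(2)[OF elim(1)] elim(2) by simp
      also have "norm (?v, ?\<Delta>) \<le> norm ?v + norm ?\<Delta>"
        by (rule norm_Pair_le)
      finally have err: "norm (?\<Delta> - D ?v) \<le> B * \<delta> * (norm ?v + norm ?\<Delta>)"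
        using B(1) \<delta>(1) by (simp add: mult_ac)
      also have "\<dots> \<le> 1 / 2 * (norm ?v + norm ?\<Delta>)"
        using \<delta>(2) by (intro mult_right_mono) auto
      finally have "norm ?\<Delta> \<le> norm (D ?v) + 1 / 2 * (norm ?v + norm ?\<Delta>)"
        using norm_triangle_sub[of ?\<Delta> "D ?v"] by linarith
      then have "norm ?\<Delta> \<le> (2 * C + 1) * norm ?v"
        using C(2)[of ?v] by (simp add: algebra_simps)
      then have "norm ?v + norm ?\<Delta> \<le> (2 * C + 2) * norm ?v"
        by (simp add: algebra_simps)
      then have "B * \<delta> * (norm ?v + norm ?\<Delta>) \<le> B * \<delta> * ((2 * C + 2) * norm ?v)"
        using B(1) \<delta>(1) by (intro mult_left_mono) auto
      also have "\<dots> \<le> e * norm ?v"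
        using mult_right_mono[OF \<delta>(3), of "norm ?v"] by (simp add: mult_ac)
      finally show ?case
        using err by linarith
    qed
  qed
  then show ?thesis
    using D unfolding has_derivative_within_alt2 D_def by blast
qed

lemma matrix_inv_left:
  fixes P :: "real^'n^'n"
  assumes ker: "\<And>h. P *v h = 0 \<Longrightarrow> h = 0"
  shows "matrix_inv P ** P = mat 1"
proof -
  obtain B where "B ** P = mat 1"
    using ker matrix_left_invertible_ker[of P] by blast
  then have "\<exists>B. P ** B = mat 1 \<and> B ** P = mat 1"
    using matrix_left_right_inverse by blast
  then show ?thesis
    unfolding matrix_inv_def by (rule someI2_ex) simp
qed

text \<open>The gradient of the squared ratio at \<open>x\<close>, up to the factor \<open>-2 / (1 + \<bar>x\<bar>\<^sup>2)\<close>. It vanishes at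
  the solution.\<close>

definition tls_gradient :: "((real^'n^'m) \<times> (real^'m)) \<times> (real^'n) \<Rightarrow> real^'n" where
  "tls_gradient = (\<lambda>((A, b), x). transpose A *v (b - A *v x)
     + ((b - A *v x) \<bullet> (b - A *v x) / (1 + x \<bullet> x)) *\<^sub>R x)"

lemma tls_gradient_tls_solution:
  fixes A :: "real^'n^'m"
  assumes "tls_generic A b"
  shows "tls_gradient ((A, b), tls_solution A b) = 0"
proof -
  let ?s = "smallest_singular_value (augmented A b)" and ?x = "tls_solution A b"
  have sol: "tls_ratio A b ?x = ?s"
    by (rule tls_ratio_tls_solution[OF assms])
  have "(b - A *v ?x) \<bullet> (b - A *v ?x) / (1 + ?x \<bullet> ?x) = (tls_ratio A b ?x)\<^sup>2"
    using one_plus_inner_pos[of ?x]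
    by (simp add: tls_ratio_def power_divide power2_norm_eq_inner less_imp_le)
  then show ?thesis
    using tls_normal_equation[OF sol] by (simp add: tls_gradient_def sol)
qed

lemma has_derivative_tls_gradient:
  fixes A :: "real^'n^'m"
  defines "r \<equiv> \<lambda>A b x. b - A *v x"
  shows "(tls_gradient has_derivative (\<lambda>((dA, db), dx).
     let dr = db - dA *v x - A *v dx;
         \<rho> = (r A b x \<bullet> r A b x) / (1 + x \<bullet> x)
     in transpose A *v dr + transpose dA *v r A b x
        + \<rho> *\<^sub>R dx + ((2 * (r A b x \<bullet> dr) - 2 * \<rho> * (x \<bullet> dx)) / (1 + x \<bullet> x)) *\<^sub>R x))
     (at ((A, b), x))"
proof -
  have transpose: "bounded_linear (transpose :: real^'n^'m \<Rightarrow> real^'m^'n)"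
    unfolding linear_conv_bounded_linear[symmetric]
    by (rule linearI) (auto simp: transpose_def vec_eq_iff)
  note mult = bounded_bilinear.FDERIV[OF bounded_bilinear_matrix_vector]
  have dx: "(snd has_derivative snd) F"
    and dA: "((\<lambda>z. fst (fst z)) has_derivative (\<lambda>z. fst (fst z))) F"
    and db: "((\<lambda>z. snd (fst z)) has_derivative (\<lambda>z. snd (fst z))) F"
    for F :: "(((real^'n^'m) \<times> (real^'m)) \<times> (real^'n)) filter"
    by (auto intro!: bounded_linear_imp_has_derivative bounded_linear_fst bounded_linear_snd
        bounded_linear_compose[OF bounded_linear_fst] bounded_linear_compose[OF bounded_linear_snd])
  let ?z = "((A, b), x)"
  define dr where "dr z = snd (fst z) - (A *v snd z + fst (fst z) *v x)"
    for z :: "((real^'n^'m) \<times> (real^'m)) \<times> (real^'n)"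
  have r: "((\<lambda>z. snd (fst z) - fst (fst z) *v snd z) has_derivative dr) (at ?z)"
    unfolding dr_def by (rule has_derivative_eq_rhs[OF has_derivative_diff[OF db mult[OF dA dx]]]) simp
  have q: "((\<lambda>z. 1 + snd z \<bullet> snd z) has_derivative (\<lambda>z. 2 * (x \<bullet> snd z))) (at ?z)"
    by (rule has_derivative_eq_rhs[OF has_derivative_add[OF has_derivative_const has_derivative_inner[OF dx dx]]])
      (simp add: inner_commute)
  have rr: "((\<lambda>z. (snd (fst z) - fst (fst z) *v snd z) \<bullet> (snd (fst z) - fst (fst z) *v snd z))
      has_derivative (\<lambda>z. 2 * (r A b x \<bullet> dr z))) (at ?z)"
    by (rule has_derivative_eq_rhs[OF has_derivative_inner[OF r r]]) (simp add: inner_commute r_def)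
  have nz: "1 + x \<bullet> x \<noteq> 0"
    using one_plus_inner_pos[of x] by simp
  have Ar: "((\<lambda>z. transpose (fst (fst z)) *v (snd (fst z) - fst (fst z) *v snd z)) has_derivative
      (\<lambda>z. transpose A *v dr z + transpose (fst (fst z)) *v r A b x)) (at ?z)"
    by (rule has_derivative_eq_rhs[OF mult[OF bounded_linear.has_derivative[OF transpose dA] r]])
      (simp add: r_def)
  have "((\<lambda>z. transpose (fst (fst z)) *v (snd (fst z) - fst (fst z) *v snd z)
       + ((snd (fst z) - fst (fst z) *v snd z) \<bullet> (snd (fst z) - fst (fst z) *v snd z) / (1 + snd z \<bullet> snd z)) *\<^sub>R snd z)
     has_derivative (\<lambda>z. transpose A *v dr z + transpose (fst (fst z)) *v r A b x
       + (((r A b x \<bullet> r A b x) / (1 + x \<bullet> x)) *\<^sub>R snd z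
         + ((2 * (r A b x \<bullet> dr z) * (1 + x \<bullet> x) - (r A b x \<bullet> r A b x) * (2 * (x \<bullet> snd z)))
             / ((1 + x \<bullet> x) * (1 + x \<bullet> x))) *\<^sub>R x))) (at ?z)"
    by (rule has_derivative_eq_rhs[OF has_derivative_add[OF Ar
            has_derivative_scaleR[OF has_derivative_divide'[OF rr q] dx]]])
      (use nz in \<open>auto simp: r_def\<close>)
  moreover have "(2 * u * (1 + x \<bullet> x) - R * (2 * w)) / ((1 + x \<bullet> x) * (1 + x \<bullet> x))
      = (2 * u - 2 * (R / (1 + x \<bullet> x)) * w) / (1 + x \<bullet> x)" for u R w :: real
    using nz by (simp add: divide_simps)
  ultimately show ?thesis
    unfolding tls_gradient_def dr_def case_prod_unfold Let_def
    by (simp add: diff_diff_eq add.commute[of "A *v _"] add.assoc)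
qed

lemma columnvector_rowvector_mult:
  fixes x :: "real^'n" and r :: "real^'m"
  shows "((columnvector x :: real^1^'n) ** (rowvector r :: real^'m^1)) *v y = (r \<bullet> y) *\<^sub>R x"
  by (simp add: vec_eq_iff matrix_vector_mult_def matrix_matrix_mult_def columnvector_def
      rowvector_def inner_vec_def sum_distrib_left sum_distrib_right mult_ac)

text \<open>At the solution, \<open>r \<bullet> A dx = - \<sigma>\<^sup>2 (x \<bullet> dx)\<close> by the normal equation, so the two \<open>dx\<close>-terms along \<open>x\<close>
  in the derivative of the gradient cancel and its \<open>dx\<close>-part is exactly \<open>-P\<close>.\<close>

theorem has_derivative_tls_solution:
  fixes A :: "real^'n^'m" and b :: "real^'m"
  defines "x \<equiv> tls_solution A b"
  defines "r \<equiv> b - A *v x"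
  defines "P \<equiv> transpose A ** A - (smallest_singular_value (augmented A b))\<^sup>2 *\<^sub>R mat 1"
  defines "K \<equiv> transpose A
             + (2 / (1 + x \<bullet> x)) *\<^sub>R ((columnvector x :: real^1^'n) ** (rowvector r :: real^'m^1))"
  assumes gen: "tls_generic A b"
  shows "((\<lambda>(A, b). tls_solution A b) has_derivative
     (\<lambda>(dA, db). matrix_inv P *v (transpose dA *v r + K *v (db - dA *v x)))) (at (A, b))"
proof -
  define s where "s = smallest_singular_value (augmented A b)"
  have sol: "tls_ratio A b x = smallest_singular_value (augmented A b)"
    unfolding x_def by (rule tls_ratio_tls_solution[OF gen])
  have normal: "transpose A *v r = - s\<^sup>2 *\<^sub>R x"
    using tls_normal_equation[OF sol] by (simp add: r_def s_def)
  have \<rho>: "r \<bullet> r / (1 + x \<bullet> x) = s\<^sup>2"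
    using sol one_plus_inner_pos[of x] unfolding s_def[symmetric]
    by (auto simp: tls_ratio_def r_def power_divide power2_norm_eq_inner less_imp_le)
  have P: "P *v h = transpose A *v (A *v h) - s\<^sup>2 *\<^sub>R h" for h
    by (simp add: P_def s_def matrix_vector_mult_diff_rdistrib matrix_vector_mul_assoc
        scaleR_matrix_vector_assoc[symmetric])
  have K: "K *v y = transpose A *v y + (2 * (r \<bullet> y) / (1 + x \<bullet> x)) *\<^sub>R x" for y
    by (simp add: K_def matrix_vector_mult_add_rdistrib scaleR_matrix_vector_assoc[symmetric]
        columnvector_rowvector_mult)
  have "h = 0" if "P *v h = 0" for h
  proof -
    have "0 = h \<bullet> (P *v h)"
      using that by simp
    also have "\<dots> = (norm (A *v h))\<^sup>2 - s\<^sup>2 * (h \<bullet> h)"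
      unfolding P inner_diff_right power2_norm_eq_inner inner_matrix_vector[of "A *v h"]
      by (simp only: inner_commute inner_scaleR_right)
    finally have "((smallest_singular_value A)\<^sup>2 - s\<^sup>2) * (h \<bullet> h) \<le> 0"
      using spectral_gap[of A "s\<^sup>2" h] by simp
    then have "h \<bullet> h \<le> 0"
      using tls_gap_pos[OF gen] by (simp add: mult_le_0_iff s_def)
    then show ?thesis
      using inner_ge_zero[of h] by (simp add: order_antisym_conv)
  qed
  then have Pinv: "matrix_inv P *v (P *v h) = h" for h
    using matrix_inv_left[of P] by (simp add: matrix_vector_mul_assoc)
  define G' where "G' = (\<lambda>((dA, db), dx). transpose dA *v r + K *v (db - dA *v x) - P *v dx)"
  have "(tls_gradient has_derivative G') (at ((A, b), x))"
  proof (rule has_derivative_eq_rhs[OF has_derivative_tls_gradient], rule ext, clarify)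
    fix dA :: "real^'n^'m" and db dx
    let ?y = "db - dA *v x"
    have "r \<bullet> (A *v dx) = - s\<^sup>2 * (x \<bullet> dx)"
      unfolding inner_matrix_vector normal by simp
    then have "2 * (r \<bullet> (?y - A *v dx)) - 2 * s\<^sup>2 * (x \<bullet> dx) = 2 * (r \<bullet> ?y)"
      by (simp add: inner_diff_right)
    then show "(let dr = ?y - A *v dx; \<rho> = (b - A *v x) \<bullet> (b - A *v x) / (1 + x \<bullet> x)
        in transpose A *v dr + transpose dA *v (b - A *v x) + \<rho> *\<^sub>R dx
          + ((2 * ((b - A *v x) \<bullet> dr) - 2 * \<rho> * (x \<bullet> dx)) / (1 + x \<bullet> x)) *\<^sub>R x)
        = G' ((dA, db), dx)"
      unfolding r_def[symmetric] \<rho> Let_def G'_def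
      by (simp add: K P) (simp add: algebra_simps matrix_vector_right_distrib)
  qed
  moreover have "isCont (\<lambda>(A, b). tls_solution A b) (A, b)"
    by (rule isCont_tls_solution[OF gen])
  moreover have "\<forall>\<^sub>F q in nhds (A, b). tls_gradient (q, (\<lambda>(A, b). tls_solution A b) q)
      = tls_gradient ((A, b), (\<lambda>(A, b). tls_solution A b) (A, b))"
    using eventually_tls_generic[OF gen]
    by eventually_elim (auto simp: tls_gradient_tls_solution gen split: prod.splits)
  moreover have "bounded_linear (\<lambda>y. - (matrix_inv P *v y))"
    by (intro bounded_linear_minus) auto
  moreover have "- (matrix_inv P *v G' (0, h)) = h" for h
    by (simp add: G'_def zero_prod_def Pinv linear_neg[OF matrix_vector_mul_linear])
  ultimately have "((\<lambda>(A, b). tls_solution A b) has_derivative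
      (\<lambda>v. - (- (matrix_inv P *v G' (v, 0))))) (at (A, b))"
    by (intro has_derivative_implicit[where F=tls_gradient and F'=G'
          and T="\<lambda>y. - (matrix_inv P *v y)" and g="\<lambda>(A, b). tls_solution A b"])
      (simp_all add: x_def)
  then show ?thesis
    by (rule has_derivative_eq_rhs) (auto simp: G'_def)
qed

section \<open>Duality of norms\<close>

text \<open>A norm on a Euclidean space is convex, hence continuous, and so has a positive minimum on the
  Euclidean unit sphere. This makes the supremum in \<^const>\<open>dual_norm\<close> a supremum of a bounded set.\<close>

lemma vector_norm_lower_bound:
  fixes N :: "'a::euclidean_space \<Rightarrow> real"
  assumes N: "is_vector_norm N"
  shows "\<exists>c>0. \<forall>v. c * norm v \<le> N v"
proof -
  have "convex_on UNIV N"
  proof (rule convex_onI)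
    fix t :: real and v w assume t: "0 < t" "t < 1"
    have "N ((1 - t) *\<^sub>R v + t *\<^sub>R w) \<le> N ((1 - t) *\<^sub>R v) + N (t *\<^sub>R w)"
      using N unfolding is_vector_norm_def by blast
    also have "\<dots> = (1 - t) * N v + t * N w"
      using N t unfolding is_vector_norm_def by simp
    finally show "N ((1 - t) *\<^sub>R v + t *\<^sub>R w) \<le> (1 - t) * N v + t * N w" .
  qed simp
  then have "continuous_on (sphere 0 1) N"
    using convex_on_continuous[of UNIV N] continuous_on_subset by auto
  moreover have "compact (sphere (0::'a) 1)" "sphere (0::'a) 1 \<noteq> {}"
    by auto
  ultimately obtain w where w: "norm w = 1" "\<And>v. norm v = 1 \<Longrightarrow> N w \<le> N v"
    using continuous_attains_inf[of "sphere 0 1" N] by (metis mem_sphere_0)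
  have "0 < N w"
    using N w(1) unfolding is_vector_norm_def by (metis norm_zero order_less_le zero_neq_one)
  moreover have "N w * norm v \<le> N v" for v
  proof (cases "v = 0")
    case False
    then have "N w \<le> N ((1 / norm v) *\<^sub>R v)"
      by (intro w(2)) simp
    also have "\<dots> = 1 / norm v * N v"
      using N unfolding is_vector_norm_def by simp
    finally show ?thesis
      using False by (simp add: field_simps)
  qed (use N in \<open>simp add: is_vector_norm_def\<close>)
  ultimately show ?thesis
    by blast
qed

lemma inner_le_vector_norm:
  assumes N: "is_vector_norm N" and u: "dual_norm N u = 1"
  shows "u \<bullet> v \<le> N v"
proof (cases "v = 0")
  case False
  then have pos: "0 < N v"
    using N unfolding is_vector_norm_def by (metis order_less_le)
  obtain c where c: "0 < c" "\<And>v. c * norm v \<le> N v"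
    using vector_norm_lower_bound[OF N] by blast
  have "bdd_above ((\<bullet>) u ` {v. N v = 1})"
  proof (rule bdd_aboveI2)
    fix w assume w: "w \<in> {v. N v = 1}"
    then have "norm w \<le> 1 / c"
      using c(1) c(2)[of w] by (simp add: field_simps)
    then show "u \<bullet> w \<le> norm u * (1 / c)"
      using norm_cauchy_schwarz[of u w] by (meson mult_left_mono norm_ge_zero order_trans)
  qed
  moreover have "N ((1 / N v) *\<^sub>R v) = \<bar>1 / N v\<bar> * N v"
    using N unfolding is_vector_norm_def by blast
  then have "N ((1 / N v) *\<^sub>R v) = 1"
    using pos by simp
  ultimately have "u \<bullet> ((1 / N v) *\<^sub>R v) \<le> dual_norm N u"
    unfolding dual_norm_def by (intro cSUP_upper) auto
  then show ?thesis
    using pos u by (simp add: field_simps)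
qed (use N in \<open>simp add: is_vector_norm_def\<close>)

text \<open>The dual functional is the normal of a hyperplane separating \<open>v\<close> from the open unit ball of
  \<open>N\<close>; it is normalized so that its supremum over the unit sphere, attained at \<open>v\<close>, equals one.\<close>

lemma norming_functional_exists_unit:
  fixes v :: "real^'k"
  assumes N: "is_vector_norm N" and v: "N v = 1"
  shows "\<exists>u. dual_norm N u = 1 \<and> u \<bullet> v = 1"
proof -
  have tri: "N (x + y) \<le> N x + N y" and hom: "N (t *\<^sub>R x) = \<bar>t\<bar> * N x" for x y t
    using N unfolding is_vector_norm_def by blast+
  define S where "S = (\<lambda>w. v - w) ` {w. N w < 1}"
  have "convex {w. N w < 1}"
  proof (rule convexI)
    fix x y and s t :: real
    assume xy: "x \<in> {w. N w < 1}" "y \<in> {w. N w < 1}" and st: "0 \<le> s" "0 \<le> t" "s + t = 1"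
    have "N (s *\<^sub>R x + t *\<^sub>R y) \<le> s * N x + t * N y"
      using tri[of "s *\<^sub>R x" "t *\<^sub>R y"] st by (simp add: hom)
    also have "\<dots> < 1"
      using xy st by (intro convex_bound_lt) auto
    finally show "s *\<^sub>R x + t *\<^sub>R y \<in> {w. N w < 1}"
      by simp
  qed
  then have "convex S"
    unfolding S_def using convex_translation[of "uminus ` {w. N w < 1}" v]
    by (simp add: convex_negations image_image)
  moreover have "0 \<notin> S"
    using v unfolding S_def by auto
  ultimately obtain a where a: "a \<noteq> 0" "\<And>x. x \<in> S \<Longrightarrow> 0 \<le> a \<bullet> x"
    using separating_hyperplane_set_0 by blast
  have open_ball: "a \<bullet> w \<le> a \<bullet> v" if "N w < 1" for w
    using a(2)[of "v - w"] that unfolding S_def by (auto simp: inner_diff_right)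
  have closed_ball: "a \<bullet> w \<le> a \<bullet> v" if w: "N w = 1" for w
  proof (rule field_le_mult_one_interval)
    fix z :: real assume "0 < z" "z < 1"
    then show "z * (a \<bullet> w) \<le> a \<bullet> v"
      using open_ball[of "z *\<^sub>R w"] w by (simp add: hom)
  qed
  have "a \<bullet> v \<noteq> 0"
  proof
    assume "a \<bullet> v = 0"
    have "0 < N a"
      using N a(1) unfolding is_vector_norm_def by (metis order_less_le)
    then have "N ((1 / N a) *\<^sub>R a) = 1"
      by (simp add: hom)
    then have "a \<bullet> a \<le> 0"
      using closed_ball[of "(1 / N a) *\<^sub>R a"] \<open>a \<bullet> v = 0\<close> \<open>0 < N a\<close>
      by (simp add: divide_le_0_iff)
    moreover have "0 < a \<bullet> a"
      using a(1) by simp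
    ultimately show False
      by linarith
  qed
  moreover have "0 \<le> a \<bullet> v"
    using open_ball[of 0] hom[of 0 0] by simp
  ultimately have pos: "0 < a \<bullet> v"
    by simp
  define u where "u = (1 / (a \<bullet> v)) *\<^sub>R a"
  have u: "u \<bullet> v = 1"
    using pos by (simp add: u_def)
  have "dual_norm N u = 1"
    unfolding dual_norm_def
  proof (rule cSup_eq_maximum)
    show "1 \<in> (\<bullet>) u ` {v. N v = 1}"
      using u v by force
    show "y \<le> 1" if "y \<in> (\<bullet>) u ` {v. N v = 1}" for y
      using that closed_ball pos by (auto simp: u_def divide_le_eq_1)
  qed
  then show ?thesis
    using u by blast
qed

lemma norming_functional_exists:
  fixes v :: "real^'k"
  assumes N: "is_vector_norm N"
  shows "\<exists>u. dual_norm N u = 1 \<and> u \<bullet> v = N v"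
proof -
  have unit: "N ((1 / N w) *\<^sub>R w) = 1" "N w \<noteq> 0" if "w \<noteq> 0" for w
    using N that unfolding is_vector_norm_def by (simp_all add: less_le)
  show ?thesis
  proof (cases "v = 0")
    case True
    obtain w :: "real^'k" where "w \<noteq> 0"
      by (metis SOME_Basis nonzero_Basis)
    then show ?thesis
      using norming_functional_exists_unit[OF N] unit(1) True N unfolding is_vector_norm_def
      by (metis inner_zero_right)
  next
    case False
    then obtain u where "dual_norm N u = 1" "u \<bullet> ((1 / N v) *\<^sub>R v) = 1"
      using norming_functional_exists_unit[OF N unit(1)] by blast
    then show ?thesis
      using unit(2)[OF False] by (auto simp: field_simps)
  qed
qed

lemma abs_inner_le_norm1:
  fixes y z :: "real^'p"
  assumes "\<And>i. \<bar>z $ i\<bar> \<le> 1"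
  shows "y \<bullet> z \<le> norm1 y"
  unfolding inner_vec_def norm1_def
proof (rule sum_mono)
  fix i
  have "y $ i * z $ i \<le> \<bar>y $ i\<bar> * \<bar>z $ i\<bar>"
    by (metis abs_ge_self abs_mult)
  also have "\<dots> \<le> \<bar>y $ i\<bar>"
    using assms[of i] by (simp add: mult_left_le)
  finally show "y $ i \<bullet> z $ i \<le> \<bar>y $ i\<bar>"
    by simp
qed

definition sign_vectors :: "(real^'p) set" where
  "sign_vectors = {z. \<forall>i. \<bar>z $ i\<bar> = 1}"

lemma finite_sign_vectors: "finite (sign_vectors :: (real^'p) set)"
proof -
  have "finite (vec_lambda ` (UNIV \<rightarrow> {-1, 1}) :: (real^'p) set)"
    using finite_PiE[of "UNIV :: 'p set" "\<lambda>_. {-1, 1 :: real}"]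
    by (simp add: PiE_UNIV_domain)
  moreover have "(sign_vectors :: (real^'p) set) \<subseteq> vec_lambda ` (UNIV \<rightarrow> {-1, 1 :: real})"
  proof
    fix z :: "real^'p" assume "z \<in> sign_vectors"
    then have "vec_nth z \<in> UNIV \<rightarrow> {-1, 1}"
      unfolding sign_vectors_def by (auto simp: abs_eq_iff')
    then show "z \<in> vec_lambda ` (UNIV \<rightarrow> {-1, 1})"
      by (metis image_eqI vec_nth_inverse)
  qed
  ultimately show ?thesis
    by (rule finite_subset[rotated])
qed

lemma norm1_attained:
  fixes y :: "real^'p"
  shows "\<exists>z\<in>sign_vectors. y \<bullet> z = norm1 y"
proof (rule bexI)
  let ?z = "\<chi> i. if y $ i < 0 then -1 else (1::real)"
  show "?z \<in> sign_vectors"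
    by (simp add: sign_vectors_def)
  show "y \<bullet> ?z = norm1 y"
    unfolding inner_vec_def norm1_def by (intro sum.cong) auto
qed

text \<open>The operator norm of \<open>B\<^sup>T\<close> from the maximum norm to \<open>N\<close> equals that of \<open>B\<close> from the dual
  norm to the 1-norm, because both are the maximum of \<open>u \<bullet> B\<^sup>T z = B u \<bullet> z\<close> over the two unit
  balls. Since the value is linear in \<open>z\<close>, sign vectors suffice, so any set of admissible \<open>z\<close>
  between the sign vectors and the unit cube gives the same maximum.\<close>

lemma max_norm_duality:
  fixes B :: "real^'k^'p" and Z :: "(real^'p) set"
  assumes N: "is_vector_norm N"
    and Z: "sign_vectors \<subseteq> Z" "\<And>z i. z \<in> Z \<Longrightarrow> \<bar>z $ i\<bar> \<le> 1"
  shows "\<exists>M. is_maximum {N (transpose B *v z) | z. z \<in> Z} M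
           \<and> is_maximum {norm1 (B *v u) | u. dual_norm N u = 1} M"
proof -
  define f where "f z = N (transpose B *v z)" for z
  have adj: "u \<bullet> (transpose B *v z) = (B *v u) \<bullet> z" for u z
    using inner_matrix_vector[of u "transpose B" z] by simp
  have ne: "sign_vectors \<noteq> ({} :: (real^'p) set)"
    using norm1_attained by blast
  define M where "M = Max (f ` sign_vectors)"
  have "M \<in> f ` sign_vectors"
    unfolding M_def using finite_sign_vectors ne by (intro Max_in) auto
  then obtain z0 where z0: "z0 \<in> sign_vectors" "M = f z0"
    by blast
  have le_M: "f z \<le> M" if "z \<in> sign_vectors" for z
    unfolding M_def using that finite_sign_vectors by (intro Max_ge) auto
  have norm1_le: "norm1 (B *v u) \<le> M" if u: "dual_norm N u = 1" for u
  proof -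
    obtain z where z: "z \<in> sign_vectors" "(B *v u) \<bullet> z = norm1 (B *v u)"
      using norm1_attained by blast
    have "norm1 (B *v u) = u \<bullet> (transpose B *v z)"
      using z(2) adj by simp
    also have "\<dots> \<le> f z"
      unfolding f_def by (rule inner_le_vector_norm[OF N u])
    finally show ?thesis
      using le_M[OF z(1)] by linarith
  qed
  have dominated: "\<exists>u. dual_norm N u = 1 \<and> f z \<le> norm1 (B *v u)" if z: "z \<in> Z" for z
  proof -
    obtain u where "dual_norm N u = 1" "u \<bullet> (transpose B *v z) = f z"
      using norming_functional_exists[OF N] unfolding f_def by blast
    then show ?thesis
      using abs_inner_le_norm1[OF Z(2)[OF z], of "B *v u"] adj by force
  qed
  have "is_maximum {f z | z. z \<in> Z} M"
    unfolding is_maximum_def using z0 Z(1) dominated norm1_le by force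
  moreover have "is_maximum {norm1 (B *v u) | u. dual_norm N u = 1} M"
  proof -
    obtain u where "dual_norm N u = 1" "M \<le> norm1 (B *v u)"
      using dominated z0 Z(1) by blast
    then show ?thesis
      unfolding is_maximum_def using norm1_le by (force intro: order_antisym)
  qed
  ultimately show ?thesis
    unfolding f_def by blast
qed

lemma is_maximum_Greatest: "is_maximum X M \<Longrightarrow> (GREATEST y. y \<in> X) = M"
  unfolding is_maximum_def by (intro Greatest_equality) auto

section \<open>The condition number\<close>

lemma diag_mat_mult: "(diag_mat d *v z) $ i = d $ i * z $ i"
  unfolding matrix_vector_mult_def diag_mat_def by (simp add: mult_delta_left)

text \<open>An infimum of one provides the bounds with factors arbitrarily close to one; the factor one
  follows in the limit.\<close>

lemma componentwise_norm_eq_one_bound: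
  assumes "componentwise_norm a b da db = 1"
  shows "\<bar>da $ i\<bar> \<le> \<bar>a $ i\<bar>" "\<bar>db $ j\<bar> \<le> \<bar>b $ j\<bar>"
proof -
  have "z * \<bar>da $ i\<bar> \<le> \<bar>a $ i\<bar> \<and> z * \<bar>db $ j\<bar> \<le> \<bar>b $ j\<bar>" if z: "0 < z" "z < 1" for z :: real
  proof -
    have "componentwise_norm a b da db < ereal (1 / z)"
      using assms z by (simp add: one_ereal_def)
    then obtain \<omega> where \<omega>: "\<omega> < 1 / z"
        "\<bar>da $ i\<bar> \<le> \<omega> * \<bar>a $ i\<bar>" "\<bar>db $ j\<bar> \<le> \<omega> * \<bar>b $ j\<bar>"
      unfolding componentwise_norm_def Inf_less_iff by auto
    have "\<omega> * c \<le> 1 / z * c" if "0 \<le> c" for c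
      using \<omega>(1) that by (intro mult_right_mono) auto
    then have "\<bar>da $ i\<bar> \<le> 1 / z * \<bar>a $ i\<bar>" "\<bar>db $ j\<bar> \<le> 1 / z * \<bar>b $ j\<bar>"
      using \<omega>(2,3) by (meson abs_ge_zero order_trans)+
    then show ?thesis
      using z by (simp add: field_simps)
  qed
  then show "\<bar>da $ i\<bar> \<le> \<bar>a $ i\<bar>" "\<bar>db $ j\<bar> \<le> \<bar>b $ j\<bar>"
    by (auto intro: field_le_mult_one_interval)
qed

text \<open>A single nonzero entry of \<open>a\<close> is perturbed by exactly its own size, which forces \<open>\<omega> \<ge> 1\<close>.
  For zero data the norm would be \<open>0\<close>.\<close>

lemma componentwise_norm_sign_vectors:
  assumes a: "a \<noteq> 0" and s: "s \<in> sign_vectors" and t: "t \<in> sign_vectors"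
  shows "componentwise_norm a b (diag_mat a *v s) (diag_mat b *v t) = 1"
proof -
  have abs: "\<bar>(diag_mat a *v s) $ i\<bar> = \<bar>a $ i\<bar>" "\<bar>(diag_mat b *v t) $ j\<bar> = \<bar>b $ j\<bar>" for i j
    using s t by (simp_all add: diag_mat_mult abs_mult sign_vectors_def)
  obtain i where i: "a $ i \<noteq> 0"
    using a by (auto simp: vec_eq_iff)
  show ?thesis
    unfolding componentwise_norm_def abs
  proof (intro antisym Inf_lower Inf_greatest)
    show "1 \<in> ereal ` {\<omega>. 0 \<le> \<omega> \<and> (\<forall>i. \<bar>a $ i\<bar> \<le> \<omega> * \<bar>a $ i\<bar>) \<and> (\<forall>j. \<bar>b $ j\<bar> \<le> \<omega> * \<bar>b $ j\<bar>)}"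
      by (auto simp: one_ereal_def)
  next
    fix y assume "y \<in> ereal ` {\<omega>. 0 \<le> \<omega> \<and> (\<forall>i. \<bar>a $ i\<bar> \<le> \<omega> * \<bar>a $ i\<bar>) \<and> (\<forall>j. \<bar>b $ j\<bar> \<le> \<omega> * \<bar>b $ j\<bar>)}"
    then obtain \<omega> where "y = ereal \<omega>" "\<bar>a $ i\<bar> \<le> \<omega> * \<bar>a $ i\<bar>"
      by auto
    then show "1 \<le> y"
      using i by (simp add: one_ereal_def)
  qed
qed

text \<open>Where an entry of \<open>d\<close> vanishes, the bound forces the same entry of \<open>w\<close> to vanish, so the value
  \<open>0 / 0 = 0\<close> of the quotient is harmless.\<close>

lemma diag_mat_factorization:
  assumes "\<And>i. \<bar>w $ i\<bar> \<le> \<bar>d $ i\<bar>"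
  shows "\<exists>z. w = diag_mat d *v z \<and> (\<forall>i. \<bar>z $ i\<bar> \<le> 1)"
proof (intro exI conjI allI)
  show "w = diag_mat d *v (\<chi> i. w $ i / d $ i)"
    using assms by (auto simp: vec_eq_iff diag_mat_mult) (metis abs_le_zero_iff abs_zero)
  show "\<bar>(\<chi> i. w $ i / d $ i) $ i\<bar> \<le> 1" for i
    using assms[of i] by (cases "d $ i = 0") (simp_all add: abs_divide divide_le_eq)
qed

text \<open>The chain rule through \<open>a \<mapsto> \<Sum>\<^sub>i a\<^sub>i S\<^sub>i\<close>. The derivative of the solution in the direction \<open>dA\<close>
  is linear in \<open>dA\<close>, and \<open>V\<close> lists its values, before multiplication by \<open>P\<^sup>-\<^sup>1\<close>, at the basis matrices.\<close>

lemma has_derivative_structured_tls_map: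
  fixes S :: "'q::finite \<Rightarrow> real^'n^'m" and L :: "real^'n^'k"
    and a :: "real^'q" and b :: "real^'m"
  defines "A \<equiv> \<Sum>i\<in>UNIV. a $ i *\<^sub>R S i"
  defines "x \<equiv> tls_solution A b"
  defines "r \<equiv> b - A *v x"
  defines "P \<equiv> transpose A ** A - (smallest_singular_value (augmented A b))\<^sup>2 *\<^sub>R mat 1"
  defines "K \<equiv> transpose A
             + (2 / (1 + x \<bullet> x)) *\<^sub>R ((columnvector x :: real^1^'n) ** (rowvector r :: real^'m^1))"
  defines "V \<equiv> \<chi> j i. (transpose (S i) *v r - K *v (S i *v x)) $ j"
  assumes gen: "tls_generic A b"
  shows "(structured_tls_map S L has_derivative
     (\<lambda>(da, db). L *v (matrix_inv P *v (V *v da + K *v db)))) (at (a, b))"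
proof -
  define \<Phi> where "\<Phi> = (\<lambda>(a, b). (\<Sum>i\<in>UNIV. a $ i *\<^sub>R S i, b :: real^'m))"
  define \<phi> where "\<phi> dA = transpose dA *v r - K *v (dA *v x)" for dA :: "real^'n^'m"
  have "linear \<Phi>"
    by (rule linearI) (auto simp: \<Phi>_def scaleR_add_left sum.distrib scaleR_right.sum)
  then have \<Phi>: "(\<Phi> has_derivative \<Phi>) (at (a, b))"
    by (intro bounded_linear_imp_has_derivative) (simp add: linear_conv_bounded_linear)
  have "transpose (X + Y) = transpose X + transpose Y" "transpose (c *\<^sub>R X) = c *\<^sub>R transpose X"
    for X Y :: "real^'n^'m" and c
    by (auto simp: transpose_def vec_eq_iff)
  then have \<phi>: "linear \<phi>"
    by (intro linearI) (auto simp: \<phi>_def matrix_vector_mult_add_rdistrib matrix_vector_right_distrib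
        matrix_vector_mult_scaleR scaleR_matrix_vector_assoc[symmetric] scaleR_diff_right)
  have V: "V *v da = \<phi> (\<Sum>i\<in>UNIV. da $ i *\<^sub>R S i)" for da
    unfolding linear_sum[OF \<phi>] linear_scale[OF \<phi>]
    by (simp add: vec_eq_iff V_def \<phi>_def matrix_vector_mult_def mult.commute)
  have map: "structured_tls_map S L = (\<lambda>p. L *v (\<lambda>(A, b). tls_solution A b) (\<Phi> p))"
    by (simp add: structured_tls_map_def \<Phi>_def fun_eq_iff)
  have "((\<lambda>(A, b). tls_solution A b) has_derivative
      (\<lambda>(dA, db). matrix_inv P *v (transpose dA *v r + K *v (db - dA *v x)))) (at (\<Phi> (a, b)))"
    using has_derivative_tls_solution[OF gen]
    unfolding P_def K_def r_def x_def \<Phi>_def case_prod_conv A_def[symmetric] .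
  from has_derivative_compose[OF \<Phi> this]
  have "((\<lambda>p. L *v (\<lambda>(A, b). tls_solution A b) (\<Phi> p)) has_derivative
      (\<lambda>p. L *v ((\<lambda>(dA, db). matrix_inv P *v (transpose dA *v r + K *v (db - dA *v x))) (\<Phi> p))))
      (at (a, b))"
    by (rule bounded_linear.has_derivative[OF matrix_vector_mul_bounded_linear])
  then show ?thesis
    unfolding map
    by (rule has_derivative_eq_rhs)
      (auto simp: fun_eq_iff \<Phi>_def V \<phi>_def matrix_vector_mult_diff_distrib algebra_simps)
qed

theorem theorem3p3:
  fixes \<S> :: "(real^'n^'m) set"
    and S :: "'q::finite \<Rightarrow> real^'n^'m"
    and a :: "real^'q" and b :: "real^'m"
    and A :: "real^'n^'m" and x :: "real^'n" and r :: "real^'m" and P :: "real^'n^'n"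
    and L :: "real^'n^'k" and N :: "real^'k \<Rightarrow> real"
    and K :: "real^'m^'n" and V :: "real^'q^'n"
    and Ns :: "real^'q^'n" and H :: "real^'m^'n"
  assumes "CARD('m) > CARD('n)" and "CARD('k) \<le> CARD('n)"
    and "subspace \<S>" and "inj S" and "independent (range S)" and "span (range S) = \<S>"
    and "A = (\<Sum>i\<in>UNIV. a $ i *\<^sub>R S i)"
    and "tls_generic A b"
    and "x = tls_solution A b"
    and "r = b - A *v x"
    and "P = transpose A ** A - (smallest_singular_value (augmented A b))\<^sup>2 *\<^sub>R mat 1"
    and "is_vector_norm N"
    and "K = transpose A
             + (2 / (1 + x \<bullet> x)) *\<^sub>R ((columnvector x :: real^1^'n) ** (rowvector r :: real^'m^1))"
    and "V = (\<chi> j i. (transpose (S i) *v r - K *v (S i *v x)) $ j)"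
    and "Ns = matrix_inv P ** V"
    and "H = matrix_inv P ** K"
  shows "is_maximum
           {norm1 ((transpose (hcat (Ns ** diag_mat a) (H ** diag_mat b)) ** transpose L) *v u)
             | u. dual_norm N u = 1}
           (componentwise_condition_number N (structured_tls_map S L) a b)
       \<and> componentwise_condition_number N (structured_tls_map S L) a b =
         dual_one_norm N (transpose (hcat (Ns ** diag_mat a) (H ** diag_mat b)) ** transpose L)"
proof -
  define D where "D = (\<lambda>(da, db). L *v (Ns *v da + H *v db))"
  define B where "B = transpose (hcat (Ns ** diag_mat a) (H ** diag_mat b)) ** transpose L"
  have "(structured_tls_map S L has_derivative D) (at (a, b))"
    using has_derivative_structured_tls_map[of a S b L] assms(7-11,13-16)
    by (simp add: D_def matrix_vector_right_distrib matrix_vector_mul_assoc)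
  then have D: "frechet_derivative (structured_tls_map S L) (at (a, b)) = D"
    by (rule frechet_derivative_at[symmetric])
  have B: "transpose B *v vconcat s t = D (diag_mat a *v s, diag_mat b *v t)" for s t
    by (simp add: B_def D_def matrix_transpose_mul matrix_vector_mul_assoc[symmetric] hcat_mult_vconcat)
  have "a \<noteq> 0"
  proof
    assume "a = 0"
    then have "A = 0"
      using assms(7) by simp
    then have "smallest_singular_value A = 0"
      using smallest_singular_value_attained[of A] by auto
    then show False
      using assms(8) smallest_singular_value_nonneg[of "augmented A b"] by (simp add: tls_generic_def)
  qed
  \<comment> \<open>The unit sphere of the componentwise norm in relative coordinates. At a zero entry of the data the
    coordinate is arbitrary; bounding it by one keeps \<open>Z\<close> inside the unit cube.\<close>
  define Z where "Z = {vconcat s t | s t. (\<forall>i. \<bar>s $ i\<bar> \<le> 1) \<and> (\<forall>j. \<bar>t $ j\<bar> \<le> 1)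
      \<and> componentwise_norm a b (diag_mat a *v s) (diag_mat b *v t) = 1}"
  have "sign_vectors \<subseteq> Z"
  proof
    fix z :: "real^('q + 'm)" assume z: "z \<in> sign_vectors"
    obtain s t where st: "z = vconcat s t"
      using vconcat_exists by blast
    have "\<bar>s $ i\<bar> = \<bar>z $ Inl i\<bar>" "\<bar>t $ j\<bar> = \<bar>z $ Inr j\<bar>" for i j
      by (simp_all add: st vconcat_def)
    then have "s \<in> sign_vectors" "t \<in> sign_vectors"
      using z by (auto simp: sign_vectors_def)
    moreover from this have "\<bar>s $ i\<bar> \<le> 1" "\<bar>t $ j\<bar> \<le> 1" for i j
      by (simp_all add: sign_vectors_def)
    ultimately show "z \<in> Z"
      using componentwise_norm_sign_vectors[OF \<open>a \<noteq> 0\<close>] unfolding Z_def st by blast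
  qed
  moreover have "\<bar>z $ i\<bar> \<le> 1" if "z \<in> Z" for z i
    using that unfolding Z_def vconcat_def by (auto split: sum.splits)
  ultimately obtain M where M: "is_maximum {N (transpose B *v z) | z. z \<in> Z} M"
      "is_maximum {norm1 (B *v u) | u. dual_norm N u = 1} M"
    using max_norm_duality[OF assms(12), of Z B] by blast
  have "{N (D (da, db)) | da db. componentwise_norm a b da db = 1} = {N (transpose B *v z) | z. z \<in> Z}"
  proof (intro equalityI subsetI)
    fix y assume "y \<in> {N (D (da, db)) | da db. componentwise_norm a b da db = 1}"
    then obtain da db where y: "y = N (D (da, db))" and unit: "componentwise_norm a b da db = 1"
      by blast
    obtain s where s: "da = diag_mat a *v s" "\<And>i. \<bar>s $ i\<bar> \<le> 1"
      using diag_mat_factorization componentwise_norm_eq_one_bound(1)[OF unit] by blast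
    obtain t where t: "db = diag_mat b *v t" "\<And>j. \<bar>t $ j\<bar> \<le> 1"
      using diag_mat_factorization componentwise_norm_eq_one_bound(2)[OF unit] by blast
    have "vconcat s t \<in> Z"
      unfolding Z_def using s t unit by blast
    then show "y \<in> {N (transpose B *v z) | z. z \<in> Z}"
      using B[of s t] y s(1) t(1) by force
  next
    fix y assume "y \<in> {N (transpose B *v z) | z. z \<in> Z}"
    then show "y \<in> {N (D (da, db)) | da db. componentwise_norm a b da db = 1}"
      unfolding Z_def using B by force
  qed
  then have "componentwise_condition_number N (structured_tls_map S L) a b = M"
    unfolding componentwise_condition_number_def D by (simp only: is_maximum_Greatest[OF M(1)])
  moreover have "dual_one_norm N B = M"
    unfolding dual_one_norm_def by (rule is_maximum_Greatest[OF M(2)])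
  ultimately show ?thesis
    using M(2) unfolding B_def by simp
qed

end
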